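(* Let $T=\begin{bmatrix} n_1 & n_2 & n_3\end{bmatrix}$ with $n_1,n_2,n_3\in\mathbb{Z}_{>0}$, let $\omega\subseteq[3]$, and let $A$ be a homogeneous $T_\omega$-robust matrix with a minimal Markov basis $M$. Then $M$ fails to be distance-reducing if and only if the following three conditions all hold: (1) $\omega=[3]$; (2) $T$ is a complete intersection; (3) $M$ contains two elements which are both circuits of $A$. In this case, $M$ distance-reduces all elements of the Graver basis $\operatorname{Gr}(A)$ except (up to sign) the only circuit of $A$ not contained in $M$.
   Context: For $z\in\mathbb{Z}^n$ write $z=z^+-z^-$ with $z^+_i=\max(z_i,0)$ and $z^-_i=\max(-z_i,0)$. For $A\in\mathbb{Z}^{d\times n}$ and a field $k$, put $\beta(z)=x^{z^+}-x^{z^-}$ and $I_A=\langle\beta(z): z\in\ker_{\mathbb{Z}}(A)\rangle\subseteq k[x_1,\dots,x_n]$ (toric ideal). Standing assumption: $\ker_{\mathbb{Z}}(A)\cap\mathbb{N}^n=\{0\}$. $A$ is homogeneous if $(1,\dots,1)\in\mathbb{Z}^n$ lies in the rational row span of $A$. $A$ (or $I_A$) is a complete intersection if the minimal number of generators of $I_A$ equals $n-\mathrm{rk}(A)$. A Markov basis for $A$ is a set $M\subseteq\ker_{\mathbb{Z}}(A)$ with $\{\beta(z):z\in M\}$ generating $I_A$; it is minimal if this generating set is minimal. A circuit of $A$ is a nonzero element of $\ker_{\mathbb{Z}}(A)$ with inclusion-minimal support and relatively prime components. $\operatorname{Gr}(A)$ is the set of nonzero $z\in\ker_{\mathbb{Z}}(A)$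 that cannot be written $z=u+v$ with nonzero $u,v\in\ker_{\mathbb{Z}}(A)$, $z^+=u^++v^+$ and $z^-=u^-+v^-$. Elements of Markov bases and circuits are considered up to sign. Bouquets: two column indices $i,j\in[n]$ of $A$ are equivalent if there are nonzero $\alpha,\beta\in\mathbb{Q}$ with $\alpha u_i+\beta u_j=0$ for all $u\in\ker_{\mathbb{Z}}(A)$. The equivalence classes $B_1,\dots,B_s$ are the bouquets of $A$; a bouquet $B$ is free if $u_i=0$ for all $i\in B$, $u\in\ker_{\mathbb{Z}}(A)$. For a non-free bouquet $B_i$, the bouquet-index-encoding vector $\mathbf{c}_i\in\mathbb{Z}^n$ is the unique integer vector with support exactly $B_i$, relatively prime nonzero entries, positive first nonzero entry, and such that for every $u\in\ker_{\mathbb{Z}}(A)$ the restriction of $u$ to $B_i$ is a multiple of the restriction of $\mathbf{c}_i$. $B_i$ is mixed if $\mathbf{c}_i$ has a negative entry and non-mixed otherwise. The bouquet matrix $A_B$ has columns $A\mathbf{c}_1,\dots,A\mathbf{c}_s$. For $T$ as in the claim and $\omega\subseteq[3]$, $A$ is $T_\omega$-robust if $I_{A_B}=I_T$ (equivalently $\ker_{\mathbb{Z}}(A_B)=\ker_{\mathbb{Z}}(T)$; so $s=3$, with the bouquets $B_1,B_2,B_3$ numbered accordingly, and there are no free bouquets) and $\omega=\{i\in[3]: B_i\text{ is non-mixed}\}$. Distance reduction: let $\lVert\cdot\rVert$ be the $1$-norm and $\le$ the component-wise order. For $\hat z,z\in\ker_{\mathbb{Z}}(A)$, $z$ is distance-reduced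 by $\hat z$ if there are signs $\varepsilon,\delta\in\{1,-1\}$ with $(\varepsilon\hat z)^+\le(\delta z)^+$ and $\lVert\delta z-\varepsilon\hat z\rVert<\lVert z\rVert$. A set $M$ distance-reduces $z$ if some element of $M$ does; $M$ is distance-reducing if it distance-reduces every nonzero element of $\ker_{\mathbb{Z}}(A)$. *)

theory Defs
  imports "HOL-Analysis.Analysis" "HOL-Library.Poly_Mapping" "HOL-Library.Numeral_Type"
begin

section \<open>Integer vectors and kernels\<close>

text \<open>
  Vectors in \<open>\<int>\<^sup>n\<close> are \<^typ>\<open>int ^ 'n\<close>, with \<^term>\<open>CARD('n) = n\<close>, and
  \<open>d \<times> n\<close> matrices are \<^typ>\<open>int ^ 'n ^ 'd\<close>. The order \<open>\<le>\<close> on vectors is component-wise.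
\<close>

definition pos_part :: "int ^ 'n \<Rightarrow> int ^ 'n" where
  "pos_part z = (\<chi> i. max (z $ i) 0)"

definition neg_part :: "int ^ 'n \<Rightarrow> int ^ 'n" where
  "neg_part z = (\<chi> i. max (- (z $ i)) 0)"

definition vec_support :: "int ^ 'n \<Rightarrow> 'n set" where
  "vec_support z = {i. z $ i \<noteq> 0}"

definition coprime_entries :: "int ^ 'n \<Rightarrow> bool" where
  "coprime_entries z \<longleftrightarrow> Gcd (range (($) z)) = 1"

definition norm1 :: "int ^ 'n::finite \<Rightarrow> int" where
  "norm1 z = (\<Sum>i\<in>UNIV. \<bar>z $ i\<bar>)"

definition int_kernel :: "int ^ 'n ^ 'd \<Rightarrow> (int ^ 'n::finite) set" where
  "int_kernel A = {z. A *v z = 0}"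

definition pointed :: "int ^ 'n ^ 'd \<Rightarrow> bool" where
  "pointed A \<longleftrightarrow> int_kernel A \<inter> {z :: int ^ 'n::finite. 0 \<le> z} = {0}"

definition rat_matrix :: "int ^ 'n ^ 'd \<Rightarrow> rat ^ 'n::finite ^ 'd::finite" where
  "rat_matrix A = map_matrix of_int A"

definition homogeneous_matrix :: "int ^ 'n::finite ^ 'd::finite \<Rightarrow> bool" where
  "homogeneous_matrix A \<longleftrightarrow> (\<chi> i. 1) \<in> vec.span (rows (rat_matrix A))"


section \<open>Toric ideals\<close>

text \<open>
  The polynomial ring \<open>k[x\<^sub>i : i \<in> 'n]\<close>: finitely supported maps from exponents to coefficients.
\<close>

type_synonym ('n, 'k) mpoly = "('n \<Rightarrow>\<^sub>0 nat) \<Rightarrow>\<^sub>0 'k"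

definition ideal_generated :: "'a::comm_ring_1 set \<Rightarrow> 'a set" where
  "ideal_generated S = module.span (*) S"

definition exponent :: "int ^ 'n::finite \<Rightarrow> ('n \<Rightarrow>\<^sub>0 nat)" where
  "exponent z = Abs_poly_mapping (\<lambda>i. nat (z $ i))"

lemma lookup_exponent [simp]: "Poly_Mapping.lookup (exponent z) i = nat (z $ i)"
  unfolding exponent_def by (subst Abs_poly_mapping_inverse) auto

definition monomial :: "int ^ 'n::finite \<Rightarrow> ('n, 'k::comm_ring_1) mpoly" where
  "monomial z = Poly_Mapping.single (exponent z) 1"

definition toric_binomial :: "int ^ 'n::finite \<Rightarrow> ('n, 'k::comm_ring_1) mpoly" where
  "toric_binomial z = monomial (pos_part z) - monomial (neg_part z)"

definition toric_ideal :: "int ^ 'n::finite ^ 'd \<Rightarrow> ('n, 'k::field) mpoly set" where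
  "toric_ideal A = ideal_generated (toric_binomial ` int_kernel A)"

definition min_num_generators :: "'a::comm_ring_1 set \<Rightarrow> nat" where
  "min_num_generators I = (LEAST m. \<exists>S. finite S \<and> card S = m \<and> ideal_generated S = I)"

text \<open>
  The field \<open>k\<close> does not occur in the types of the remaining arguments, so it is passed as a
  type argument.
\<close>

definition complete_intersection :: "'k::field itself \<Rightarrow> int ^ 'n::finite ^ 'd::finite \<Rightarrow> bool" where
  "complete_intersection K A \<longleftrightarrow>
     min_num_generators (toric_ideal A :: ('n, 'k) mpoly set) = CARD('n) - rank (rat_matrix A)"

definition markov_basis ::
  "'k::field itself \<Rightarrow> int ^ 'n::finite ^ 'd \<Rightarrow> (int ^ 'n) set \<Rightarrow> bool" where
  "markov_basis K A M \<longleftrightarrow>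
     M \<subseteq> int_kernel A \<and>
     ideal_generated (toric_binomial ` M) = (toric_ideal A :: ('n, 'k) mpoly set)"

text \<open>
  Minimality is inclusion-minimality of the generating set of binomials. In particular, a minimal
  Markov basis does not contain both \<open>z\<close> and \<open>- z\<close>.
\<close>

definition minimal_markov_basis ::
  "'k::field itself \<Rightarrow> int ^ 'n::finite ^ 'd \<Rightarrow> (int ^ 'n) set \<Rightarrow> bool" where
  "minimal_markov_basis K A M \<longleftrightarrow>
     markov_basis K A M \<and>
     (\<forall>S. S \<subset> (toric_binomial ` M :: ('n, 'k) mpoly set) \<longrightarrow> ideal_generated S \<noteq> toric_ideal A)"


section \<open>Circuits and the Graver basis\<close>

definition circuit :: "int ^ 'n::finite ^ 'd \<Rightarrow> int ^ 'n \<Rightarrow> bool" where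
  "circuit A u \<longleftrightarrow>
     u \<in> int_kernel A \<and> u \<noteq> 0 \<and>
     (\<forall>v\<in>int_kernel A. v \<noteq> 0 \<longrightarrow> \<not> vec_support v \<subset> vec_support u) \<and>
     coprime_entries u"

definition graver_basis :: "int ^ 'n::finite ^ 'd \<Rightarrow> (int ^ 'n) set" where
  "graver_basis A =
     {z \<in> int_kernel A. z \<noteq> 0 \<and>
        \<not> (\<exists>u\<in>int_kernel A. \<exists>v\<in>int_kernel A.
             u \<noteq> 0 \<and> v \<noteq> 0 \<and> z = u + v \<and>
             pos_part z = pos_part u + pos_part v \<and>
             neg_part z = neg_part u + neg_part v)}"


section \<open>Bouquets\<close>

definition bouquet_equiv :: "int ^ 'n::finite ^ 'd \<Rightarrow> ('n \<times> 'n) set" where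
  "bouquet_equiv A =
     {(i, j). \<exists>\<alpha> \<beta> :: rat. \<alpha> \<noteq> 0 \<and> \<beta> \<noteq> 0 \<and>
        (\<forall>u\<in>int_kernel A. \<alpha> * of_int (u $ i) + \<beta> * of_int (u $ j) = 0)}"

definition bouquets :: "int ^ 'n::finite ^ 'd \<Rightarrow> 'n set set" where
  "bouquets A = UNIV // bouquet_equiv A"

definition free_bouquet :: "int ^ 'n::finite ^ 'd \<Rightarrow> 'n set \<Rightarrow> bool" where
  "free_bouquet A B \<longleftrightarrow> (\<forall>i\<in>B. \<forall>u\<in>int_kernel A. u $ i = 0)"

text \<open>
  The vector \<open>c\<^sub>B\<close>. It is unique, and hence meaningful, only for bouquets \<open>B\<close> that are not free.
  Its first nonzero entry sits at position \<open>Min B\<close> because its support is \<open>B\<close>.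
\<close>

definition bouquet_vector ::
  "int ^ 'n::{finite,linorder} ^ 'd \<Rightarrow> 'n set \<Rightarrow> int ^ 'n::{finite,linorder}" where
  "bouquet_vector A B =
     (THE c. vec_support c = B \<and> coprime_entries c \<and> c $ Min B > 0 \<and>
        (\<forall>u\<in>int_kernel A. \<exists>m. \<forall>i\<in>B. u $ i = m * c $ i))"

definition mixed_bouquet :: "int ^ 'n::{finite,linorder} ^ 'd \<Rightarrow> 'n set \<Rightarrow> bool" where
  "mixed_bouquet A B \<longleftrightarrow> (\<exists>i. bouquet_vector A B $ i < 0)"

text \<open>
  The matrix \<open>A\<^sub>B\<close> with respect to a numbering \<open>B\<close> of the bouquets by an index type \<open>'m\<close>.
\<close>

definition bouquet_matrix ::
  "int ^ 'n::{finite,linorder} ^ 'd \<Rightarrow> ('m \<Rightarrow> 'n set) \<Rightarrow> int ^ 'm ^ 'd" where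
  "bouquet_matrix A B = (\<chi> r j. (A *v bouquet_vector A (B j)) $ r)"

definition row_matrix3 :: "int \<Rightarrow> int \<Rightarrow> int \<Rightarrow> int ^ 3 ^ 1" where
  "row_matrix3 n1 n2 n3 = vector [vector [n1, n2, n3]]"

text \<open>
  The index set \<open>[3]\<close> is the type \<^typ>\<open>3\<close>, whose elements are \<open>1\<close>, \<open>2\<close> and \<open>3\<close> (\<open>= 0\<close>).
\<close>

definition robust :: "'k::field itself \<Rightarrow> int ^ 3 ^ 1 \<Rightarrow> 3 set \<Rightarrow>
    int ^ 'n::{finite,linorder} ^ 'd \<Rightarrow> bool" where
  "robust K T \<omega> A \<longleftrightarrow>
     (\<exists>B :: 3 \<Rightarrow> 'n set.
        bij_betw B UNIV (bouquets A) \<and>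
        (\<forall>i. \<not> free_bouquet A (B i)) \<and>
        toric_ideal (bouquet_matrix A B) = (toric_ideal T :: (3, 'k) mpoly set) \<and>
        \<omega> = {i. \<not> mixed_bouquet A (B i)})"


section \<open>Distance reduction\<close>

definition distance_reduced_by :: "int ^ 'n::finite \<Rightarrow> int ^ 'n \<Rightarrow> bool" where
  "distance_reduced_by z zh \<longleftrightarrow>
     (\<exists>\<epsilon>\<in>{1, -1}. \<exists>\<delta>\<in>{1, -1}.
        pos_part (\<epsilon> *s zh) \<le> pos_part (\<delta> *s z) \<and>
        norm1 (\<delta> *s z - \<epsilon> *s zh) < norm1 z)"

definition distance_reduces :: "(int ^ 'n::finite) set \<Rightarrow> int ^ 'n \<Rightarrow> bool" where
  "distance_reduces M z \<longleftrightarrow> (\<exists>zh\<in>M. distance_reduced_by z zh)"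

definition distance_reducing :: "int ^ 'n::finite ^ 'd \<Rightarrow> (int ^ 'n) set \<Rightarrow> bool" where
  "distance_reducing A M \<longleftrightarrow> (\<forall>z\<in>int_kernel A. z \<noteq> 0 \<longrightarrow> distance_reduces M z)"

end

theory Submission
  imports Defs
begin

text \<open>
  Three ideas carry the proof.

  \<^bold>\<open>Walks instead of polynomials.\<close> A difference of two monomials lies in the ideal generated by a
  set of binomials iff the two exponents are joined by a walk in the nonnegative orthant whose steps
  are, up to sign, the vectors of these binomials (\<open>toric_binomial_in_ideal_iff_walk\<close>). Hence a
  Markov basis \<open>M\<close> connects \<open>z\<^sup>+\<close> with \<open>z\<^sup>-\<close> for every kernel element \<open>z\<close>, and if \<open>M\<close> is minimal
  then no \<open>m \<in> M\<close> has its two parts connected by the moves different from \<open>m\<close> and \<open>- m\<close>. These two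
  properties are all that is needed of \<open>M\<close>, and they do not involve the field.

  \<^bold>\<open>Reduction is a statement about supports.\<close> The entries of every kernel element of a homogeneous
  matrix sum to zero. If \<open>m\<^sup>+ \<le> z\<^sup>+\<close>, then passing from \<open>z\<close> to \<open>z - m\<close> decreases the norm iff \<open>m\<close> and
  \<open>z\<close> have a common negative coordinate (\<open>norm1_diff_less_iff\<close>). Write \<open>z\<close> as the image \<open>D u\<close> of
  \<open>u \<in> ker T\<close>, where coordinate \<open>l\<close> of \<open>u\<close> is multiplied with the encoding vector of bouquet \<open>l\<close>. The
  first step of a walk from \<open>z\<^sup>+\<close> and the first step of a walk from \<open>z\<^sup>-\<close> each give a move
  fitting below \<open>z\<close> or \<open>- z\<close>. If it is nonzero in a mixed bouquet, or negative at a common coordinate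
  with that vector, then it reduces \<open>z\<close>. Comparing signs leaves a single configuration
  for a vector that is not reduced: no bouquet is mixed, \<open>u\<close> has sign pattern \<open>(+, -, 0)\<close>, and \<open>\<plusminus>M\<close>
  contains images of vectors with patterns \<open>(+, 0, -)\<close> and \<open>(0, +, -)\<close> (\<open>unreduced_edge\<close>).

  \<^bold>\<open>Two such moves are the whole basis.\<close> If no bouquet is mixed, then \<open>D\<close> identifies walks for \<open>A\<close>
  with walks for \<open>T\<close>, so the rest happens in the plane \<open>ker T \<subseteq> \<int>\<^sup>3\<close>. Let \<open>v\<close> and \<open>v'\<close> be the two
  vectors above. If they did not generate the lattice \<open>ker T\<close>, it would have a point in the open
  parallelogram which they span, and this point would supply a detour replacing \<open>v\<close> or \<open>v'\<close>, against
  minimality (\<open>no_interior_point\<close>). A lattice basis with these sign patterns connects all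
  fibres (\<open>two_moves_connect\<close>). Therefore \<open>v\<close> and \<open>v'\<close> are circuits, \<open>I\<^sub>T\<close> is generated by their two
  binomials, and \<open>M\<close> has no elements besides \<open>\<plusminus>D v\<close>, \<open>\<plusminus>D v'\<close>. The ideal \<open>I\<^sub>T\<close> is not principal,
  because the gradients of the elements of a principal ideal at a zero of the ideal are parallel
  (\<open>toric_ideal_of_plane_not_principal\<close>), so \<open>T\<close> is a complete intersection.

  Conversely, two different circuits in \<open>M\<close> are, up to sign and numbering, such \<open>v\<close> and \<open>v'\<close>. The third
  circuit, of pattern \<open>(+, -, 0)\<close>, is not reduced by them, and every vector that is not reduced is a
  multiple of it (\<open>unreduced_graver_is_third_circuit\<close>).
\<close>

section \<open>Binomial ideals and walks in fibres\<close>

lemma module_ring_mult: "module ((*) :: 'a::comm_ring_1 \<Rightarrow> 'a \<Rightarrow> 'a)"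
  by unfold_locales (auto simp: algebra_simps)

lemmas ideal_zero = module.span_zero[OF module_ring_mult, folded ideal_generated_def]
  and ideal_base = module.span_base[OF module_ring_mult, folded ideal_generated_def]
  and ideal_add = module.span_add[OF module_ring_mult, folded ideal_generated_def]
  and ideal_neg = module.span_neg[OF module_ring_mult, folded ideal_generated_def]
  and ideal_scale = module.span_scale[OF module_ring_mult, folded ideal_generated_def]
  and ideal_mono = module.span_mono[OF module_ring_mult, folded ideal_generated_def]
  and ideal_singleton = module.span_singleton[OF module_ring_mult, folded ideal_generated_def]

lemma ideal_empty: "ideal_generated {} = {0 :: 'a::comm_ring_1}"
  by (simp add: ideal_generated_def module.span_empty[OF module_ring_mult])

lemma ideal_generated_subset:
  assumes "S \<subseteq> ideal_generated S'"
  shows "ideal_generated S \<subseteq> ideal_generated S'"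
  using module.span_mono[OF module_ring_mult assms]
  by (simp add: ideal_generated_def module.span_span[OF module_ring_mult])

lemma ideal_induct [consumes 1, case_names zero step]:
  assumes "x \<in> ideal_generated S" "P 0" "\<And>c x y. x \<in> S \<Longrightarrow> P y \<Longrightarrow> P (c * x + y)"
  shows "P (x :: 'a::comm_ring_1)"
  using module.span_induct_alt[OF module_ring_mult, of x S P] assms
  unfolding ideal_generated_def by blast

lemma poly_mapping_single_induct [case_names zero single]:
  assumes "P 0" "\<And>a c f. P f \<Longrightarrow> P (Poly_Mapping.single a c + f)"
  shows "P (f :: 'a \<Rightarrow>\<^sub>0 'b::comm_monoid_add)"
proof (induction f rule: update_induct)
  case (update f a b)
  have "Poly_Mapping.update a b f = Poly_Mapping.single a b + f"
    using update.hyps(1) by (intro poly_mapping_eqI)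
      (auto simp: lookup_update lookup_add lookup_single when_def in_keys_iff)
  then show ?case using assms(2) update.IH by simp
qed (rule assms(1))

text \<open>
  All linear functionals used below have this shape: the sum of the coefficients over a set of
  exponents, the evaluation at \<open>(1, \<dots>, 1)\<close>, and the partial derivatives at that point.
\<close>

definition weighted_sum :: "('a \<Rightarrow> 'k) \<Rightarrow> ('a \<Rightarrow>\<^sub>0 'k::comm_ring_1) \<Rightarrow> 'k" where
  "weighted_sum h f = (\<Sum>a\<in>Poly_Mapping.keys f. h a * Poly_Mapping.lookup f a)"

lemma weighted_sum_superset:
  assumes "finite S" "Poly_Mapping.keys f \<subseteq> S"
  shows "weighted_sum h f = (\<Sum>a\<in>S. h a * Poly_Mapping.lookup f a)"
  unfolding weighted_sum_def
  by (rule sum.mono_neutral_left) (use assms in \<open>auto simp: in_keys_iff\<close>)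

lemma weighted_sum_add: "weighted_sum h (f + g) = weighted_sum h f + weighted_sum h g"
proof -
  let ?S = "Poly_Mapping.keys f \<union> Poly_Mapping.keys g"
  have "weighted_sum h u = (\<Sum>a\<in>?S. h a * Poly_Mapping.lookup u a)" if "u \<in> {f, g, f + g}" for u
    using that keys_add[of f g] by (intro weighted_sum_superset) auto
  then show ?thesis
    by (simp add: lookup_add algebra_simps sum.distrib)
qed

lemma weighted_sum_zero [simp]: "weighted_sum h 0 = 0"
  by (simp add: weighted_sum_def)

lemma weighted_sum_uminus: "weighted_sum h (- f) = - weighted_sum h f"
  using weighted_sum_add[of h f "- f"] by (simp add: eq_neg_iff_add_eq_0 add.commute)

lemma weighted_sum_diff: "weighted_sum h (f - g) = weighted_sum h f - weighted_sum h g"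
  using weighted_sum_add[of h f "- g"] by (simp add: weighted_sum_uminus)

lemma weighted_sum_single [simp]: "weighted_sum h (Poly_Mapping.single a c) = h a * c"
  by (simp add: weighted_sum_def)

lemma weighted_sum_single_mult:
  "weighted_sum h (Poly_Mapping.single a c * g) = c * weighted_sum (\<lambda>b. h (a + b)) g"
  by (induction g rule: poly_mapping_single_induct)
    (simp_all add: algebra_simps weighted_sum_add mult_single)

lemma weighted_sum_mult_eq_0:
  assumes "\<And>a. weighted_sum (\<lambda>b. h (a + b)) g = 0"
  shows "weighted_sum h (f * g) = 0"
  by (induction f rule: poly_mapping_single_induct)
    (simp_all add: algebra_simps weighted_sum_add weighted_sum_single_mult assms)

lemma exponent_add:
  assumes "0 \<le> x" "0 \<le> y"
  shows "exponent (x + y) = exponent x + exponent y"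
  using assms by (intro poly_mapping_eqI) (auto simp: lookup_add less_eq_vec_def nat_add_distrib)

lemma monomial_add:
  assumes "0 \<le> x" "0 \<le> y"
  shows "monomial (x + y) = (monomial x * monomial y :: ('n::finite, 'k::comm_ring_1) mpoly)"
  using assms by (simp add: monomial_def exponent_add mult_single)

definition vec_of_exponent :: "('n::finite \<Rightarrow>\<^sub>0 nat) \<Rightarrow> int ^ 'n" where
  "vec_of_exponent a = (\<chi> i. int (Poly_Mapping.lookup a i))"

lemma vec_of_exponent_inverse [simp]: "0 \<le> x \<Longrightarrow> vec_of_exponent (exponent x) = x"
  by (simp add: vec_of_exponent_def vec_eq_iff less_eq_vec_def)

lemma vec_of_exponent_add: "vec_of_exponent (a + b) = vec_of_exponent a + vec_of_exponent b"
  by (simp add: vec_of_exponent_def vec_eq_iff lookup_add)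

lemma vec_of_exponent_nonneg [simp]: "0 \<le> vec_of_exponent a"
  by (simp add: vec_of_exponent_def less_eq_vec_def)

lemma pos_part_nth [simp]: "pos_part z $ i = max (z $ i) 0"
  and neg_part_nth [simp]: "neg_part z $ i = max (- (z $ i)) 0"
  by (simp_all add: pos_part_def neg_part_def)

lemma pos_part_nonneg [simp]: "0 \<le> pos_part z" and neg_part_nonneg [simp]: "0 \<le> neg_part z"
  by (simp_all add: less_eq_vec_def)

lemma vec_add_nonneg: "0 \<le> x \<Longrightarrow> 0 \<le> y \<Longrightarrow> 0 \<le> x + (y :: int ^ 'n::finite)"
  by (simp add: less_eq_vec_def)

lemma pos_minus_neg [simp]: "pos_part z - neg_part z = z"
  by (auto simp: vec_eq_iff max_def)

lemma pos_part_uminus [simp]: "pos_part (- z) = neg_part z"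
  and neg_part_uminus [simp]: "neg_part (- z) = pos_part z"
  by (simp_all add: vec_eq_iff)

lemma toric_binomial_uminus: "toric_binomial (- z) = - toric_binomial z"
  by (simp add: toric_binomial_def)

text \<open>
  One step adds or subtracts an element of \<open>S\<close> inside the nonnegative orthant. If \<open>x\<close> and \<open>y\<close> are
  nonnegative and \<open>x - y = m\<close>, then \<open>m\<^sup>+ \<le> x\<close> and \<open>m\<^sup>- \<le> y\<close>, so a step is the same as a monomial
  multiple of a binomial. Integer vectors are used instead of exponents because steps are compared by
  subtraction.
\<close>

definition moves :: "(int ^ 'n::finite) set \<Rightarrow> ((int ^ 'n) \<times> (int ^ 'n)) set" where
  "moves S = {(x, y). 0 \<le> x \<and> 0 \<le> y \<and> (x - y \<in> S \<or> y - x \<in> S)}"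

lemma sym_moves: "sym (moves S)"
  by (auto simp: moves_def sym_def)

lemma walk_sym: "(x, y) \<in> (moves S)\<^sup>* \<Longrightarrow> (y, x) \<in> (moves S)\<^sup>*"
  by (meson sym_moves sym_rtrancl symE)

lemma walk_translate:
  assumes "(x, y) \<in> (moves S)\<^sup>*" "0 \<le> t"
  shows "(x + t, y + t) \<in> (moves S)\<^sup>*"
  using assms(1)
proof (induction rule: rtrancl_induct)
  case (step y z)
  have "(y + t, z + t) \<in> moves S"
    using step.hyps(2) assms(2) by (auto simp: moves_def less_eq_vec_def)
  with step.IH show ?case by (rule rtrancl_into_rtrancl)
qed simp

text \<open>
  Summing the coefficients over the exponents that can be reached from \<open>x\<close> gives a linear functional
  which vanishes on all monomial multiples of the generating binomials, hence on the ideal. On the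
  difference of the two monomials its value is \<open>1\<close> if \<open>y\<close> cannot be reached.
\<close>

lemma walk_if_binomial_in_ideal:
  fixes S :: "(int ^ 'n::finite) set"
  assumes "(monomial x - monomial y :: ('n, 'k::comm_ring_1) mpoly)
             \<in> ideal_generated (toric_binomial ` S)" "0 \<le> x" "0 \<le> y"
  shows "(x, y) \<in> (moves S)\<^sup>*"
proof -
  define h :: "('n \<Rightarrow>\<^sub>0 nat) \<Rightarrow> 'k"
    where "h a = (if (x, vec_of_exponent a) \<in> (moves S)\<^sup>* then 1 else 0)" for a
  have "weighted_sum h f = 0" if "f \<in> ideal_generated (toric_binomial ` S)" for f
    using that
  proof (induction rule: ideal_induct)
    case (step c p f)
    then obtain m where m: "m \<in> S" "p = toric_binomial m" by auto
    have "weighted_sum (\<lambda>b. h (a + b)) p = 0" for a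
    proof -
      let ?p = "vec_of_exponent a + pos_part m" and ?n = "vec_of_exponent a + neg_part m"
      have "?p - ?n = m"
        using pos_minus_neg[of m] by (simp add: algebra_simps del: pos_minus_neg)
      then have "(?p, ?n) \<in> moves S"
        using m(1) by (simp add: moves_def vec_add_nonneg)
      then have "(x, ?p) \<in> (moves S)\<^sup>* \<longleftrightarrow> (x, ?n) \<in> (moves S)\<^sup>*"
        using sym_moves[of S] by (meson rtrancl_into_rtrancl symD)
      then show ?thesis
        by (simp add: m(2) toric_binomial_def monomial_def weighted_sum_diff h_def
            vec_of_exponent_add)
    qed
    then show ?case
      using step by (simp add: weighted_sum_add weighted_sum_mult_eq_0)
  qed simp
  from this[OF assms(1)] show ?thesis
    using assms(2,3) by (auto simp: weighted_sum_diff monomial_def h_def split: if_splits)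
qed

text \<open>
  The difference telescopes along the walk.
\<close>

lemma binomial_in_ideal_if_walk:
  fixes S :: "(int ^ 'n::finite) set"
  assumes "(x, y) \<in> (moves S)\<^sup>*"
  shows "(monomial x - monomial y :: ('n, 'k::comm_ring_1) mpoly)
           \<in> ideal_generated (toric_binomial ` S)"
  using assms
proof (induction rule: rtrancl_induct)
  case base
  show ?case by (simp add: ideal_zero)
next
  case (step y z)
  have *: "(monomial y - monomial z :: ('n, 'k) mpoly) \<in> ideal_generated (toric_binomial ` S)"
    if "0 \<le> y" "0 \<le> z" "y - z \<in> S" for y z
  proof -
    define g where "g = y - pos_part (y - z)"
    have g: "0 \<le> g" "y = g + pos_part (y - z)" "z = g + neg_part (y - z)"
      using that by (auto simp: g_def less_eq_vec_def vec_eq_iff)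
    have "(monomial y :: ('n, 'k) mpoly) = monomial g * monomial (pos_part (y - z))"
      using monomial_add[OF g(1) pos_part_nonneg] g(2) by metis
    moreover have "(monomial z :: ('n, 'k) mpoly) = monomial g * monomial (neg_part (y - z))"
      using monomial_add[OF g(1) neg_part_nonneg] g(3) by metis
    ultimately have "(monomial y - monomial z :: ('n, 'k) mpoly) = monomial g * toric_binomial (y - z)"
      by (simp add: toric_binomial_def algebra_simps)
    then show ?thesis using that(3) by (simp add: ideal_scale ideal_base)
  qed
  have "(monomial y - monomial z :: ('n, 'k) mpoly) \<in> ideal_generated (toric_binomial ` S)"
    using step.hyps(2) *[of y z] ideal_neg[OF *[of z y]] by (auto simp: moves_def)
  from ideal_add[OF step.IH this] show ?case by simp
qed

lemma toric_binomial_in_ideal_iff_walk: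
  "(toric_binomial z :: ('n::finite, 'k::comm_ring_1) mpoly) \<in> ideal_generated (toric_binomial ` S)
     \<longleftrightarrow> (pos_part z, neg_part z) \<in> (moves S)\<^sup>*"
  unfolding toric_binomial_def
  using walk_if_binomial_in_ideal binomial_in_ideal_if_walk pos_part_nonneg neg_part_nonneg
  unfolding toric_binomial_def by blast

lemma exponent_eq_iff: "0 \<le> x \<Longrightarrow> 0 \<le> y \<Longrightarrow> exponent x = exponent y \<longleftrightarrow> x = y"
  by (metis vec_of_exponent_inverse)

text \<open>
  Over a field of characteristic \<open>2\<close> the binomials of \<open>z\<close> and \<open>- z\<close> coincide, so the sign cannot be
  recovered.
\<close>

lemma toric_binomial_eq_imp:
  assumes "(toric_binomial z :: ('n::finite, 'k::comm_ring_1) mpoly) = toric_binomial z'"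
  shows "z = z' \<or> z = - z'"
proof (cases "z = 0 \<or> z' = 0")
  case True
  have nz: "z = 0" if "(toric_binomial z :: ('n, 'k) mpoly) = 0" for z
  proof -
    have "monomial (pos_part z) = (monomial (neg_part z) :: ('n, 'k) mpoly)"
      using that by (simp add: toric_binomial_def)
    from arg_cong[OF this, of Poly_Mapping.keys]
    have "exponent (pos_part z) = exponent (neg_part z)"
      by (simp add: monomial_def)
    then show ?thesis
      by (metis exponent_eq_iff neg_part_nonneg pos_minus_neg pos_part_nonneg right_minus_eq)
  qed
  have "(toric_binomial 0 :: ('n, 'k) mpoly) = 0"
  proof -
    have "pos_part (0 :: int ^ 'n) = neg_part 0" by (simp add: vec_eq_iff)
    then show ?thesis by (simp add: toric_binomial_def)
  qed
  then show ?thesis using True assms nz[of z] nz[of z'] by auto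
next
  case False
  define p q p' q' where "p = exponent (pos_part z)" "q = exponent (neg_part z)"
    "p' = exponent (pos_part z')" "q' = exponent (neg_part z')"
  note d = this
  have pq: "p \<noteq> q" "p' \<noteq> q'"
    using False pos_minus_neg[of z] pos_minus_neg[of z']
    by (auto simp: d exponent_eq_iff simp del: pos_minus_neg)
  have "Poly_Mapping.lookup (Poly_Mapping.single p (1::'k) - Poly_Mapping.single q 1) a
      = Poly_Mapping.lookup (Poly_Mapping.single p' (1::'k) - Poly_Mapping.single q' 1) a" for a
    using assms by (simp add: toric_binomial_def monomial_def d)
  from this[of p] this[of q] this[of p'] this[of q'] pq
  have "p = p' \<and> q = q' \<or> p = q' \<and> q = p'"
    by (auto simp: lookup_minus lookup_single when_def split: if_splits)
  then have "pos_part z = pos_part z' \<and> neg_part z = neg_part z' \<or>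
      pos_part z = neg_part z' \<and> neg_part z = pos_part z'"
    by (simp add: d exponent_eq_iff)
  then show ?thesis
    by (metis minus_diff_eq pos_minus_neg)
qed

text \<open>
  The right-hand side does not mention the field: being a Markov basis is combinatorial.
\<close>

lemma markov_basis_iff_walks:
  fixes A :: "int ^ 'n::finite ^ 'd"
  shows "markov_basis TYPE('k::field) A M \<longleftrightarrow>
    M \<subseteq> int_kernel A \<and> (\<forall>z\<in>int_kernel A. (pos_part z, neg_part z) \<in> (moves M)\<^sup>*)"
proof -
  have "(ideal_generated (toric_binomial ` M) = (toric_ideal A :: ('n, 'k) mpoly set)) \<longleftrightarrow>
      (\<forall>z\<in>int_kernel A. (toric_binomial z :: ('n, 'k) mpoly) \<in> ideal_generated (toric_binomial ` M))"
    if "M \<subseteq> int_kernel A"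
  proof
    assume "ideal_generated (toric_binomial ` M) = (toric_ideal A :: ('n, 'k) mpoly set)"
    then show "\<forall>z\<in>int_kernel A. (toric_binomial z :: ('n, 'k) mpoly)
        \<in> ideal_generated (toric_binomial ` M)"
      by (simp add: toric_ideal_def ideal_base)
  next
    assume "\<forall>z\<in>int_kernel A. (toric_binomial z :: ('n, 'k) mpoly)
        \<in> ideal_generated (toric_binomial ` M)"
    then show "ideal_generated (toric_binomial ` M) = (toric_ideal A :: ('n, 'k) mpoly set)"
      unfolding toric_ideal_def
      by (intro equalityI ideal_mono ideal_generated_subset image_mono that) auto
  qed
  then show ?thesis
    unfolding markov_basis_def by (auto simp: toric_binomial_in_ideal_iff_walk)
qed

text \<open>
  Two points of a fibre differ from \<open>z\<^sup>+\<close> and \<open>z\<^sup>-\<close> by a common nonnegative vector.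
\<close>

lemma walk_between_fibre_points:
  assumes "\<And>z. z \<in> L \<Longrightarrow> (pos_part z, neg_part z) \<in> (moves S)\<^sup>*"
    and "0 \<le> x" "0 \<le> y" "x - y \<in> L"
  shows "(x, y) \<in> (moves S)\<^sup>*"
proof -
  define t where "t = x - pos_part (x - y)"
  have t: "0 \<le> t" "x = pos_part (x - y) + t" "y = neg_part (x - y) + t"
    using assms(2,3) by (auto simp: t_def less_eq_vec_def vec_eq_iff)
  show ?thesis using walk_translate[OF assms(1)[OF assms(4)] t(1)] t(2,3) by simp
qed

text \<open>
  A walk avoiding \<open>m\<close> would make the binomial of \<open>m\<close> superfluous. Both signs are removed because in
  characteristic \<open>2\<close> a minimal Markov basis can contain \<open>m\<close> together with \<open>- m\<close>.
\<close>

lemma minimal_markov_basis_indispensable: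
  fixes A :: "int ^ 'n::finite ^ 'd"
  assumes "minimal_markov_basis TYPE('k::field) A M" "m \<in> M"
  shows "(pos_part m, neg_part m) \<notin> (moves (M - {m, - m}))\<^sup>*"
proof
  assume walk: "(pos_part m, neg_part m) \<in> (moves (M - {m, - m}))\<^sup>*"
  let ?S = "toric_binomial ` (M - {m, - m}) :: ('n, 'k) mpoly set"
  have m: "toric_binomial m \<in> ideal_generated ?S"
    using walk by (simp add: toric_binomial_in_ideal_iff_walk)
  have "toric_binomial m \<notin> ?S"
    using toric_binomial_eq_imp[of m, where ?'k = 'k] by fastforce
  then have "?S \<subset> toric_binomial ` M" using assms(2) by blast
  moreover have "ideal_generated ?S = toric_ideal A"
  proof -
    have "toric_binomial x \<in> ideal_generated ?S" if "x \<in> M" for x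
    proof (cases "x \<in> {m, - m}")
      case True
      then show ?thesis using m ideal_neg[OF m] by (auto simp: toric_binomial_uminus)
    next
      case False
      then show ?thesis using that by (intro ideal_base imageI) simp
    qed
    then have "ideal_generated (toric_binomial ` M) \<subseteq> ideal_generated ?S"
      by (intro ideal_generated_subset) auto
    moreover have "ideal_generated ?S \<subseteq> ideal_generated (toric_binomial ` M)"
      by (intro ideal_mono image_mono) auto
    ultimately show ?thesis
      using assms(1) by (simp add: minimal_markov_basis_def markov_basis_def)
  qed
  ultimately show False
    using assms(1) by (simp add: minimal_markov_basis_def)
qed

section \<open>Minimal Markov bases in the plane of relations of three positive weights\<close>

definition weight :: "int ^ 3 \<Rightarrow> int ^ 3 \<Rightarrow> int" where
  "weight N x = (\<Sum>l\<in>UNIV. N $ l * x $ l)"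

definition plane :: "int ^ 3 \<Rightarrow> (int ^ 3) set" where
  "plane N = {w. weight N w = 0}"

lemma weight_add: "weight N (x + y) = weight N x + weight N y"
  and weight_diff: "weight N (x - y) = weight N x - weight N y"
  and weight_uminus: "weight N (- x) = - weight N x"
  and weight_scale: "weight N (c *s x) = c * weight N x"
  by (simp_all add: weight_def algebra_simps sum.distrib sum_subtractf sum_negf sum_distrib_left)

lemma plane_add: "x \<in> plane N \<Longrightarrow> y \<in> plane N \<Longrightarrow> x + y \<in> plane N"
  and plane_diff: "x \<in> plane N \<Longrightarrow> y \<in> plane N \<Longrightarrow> x - y \<in> plane N"
  and plane_uminus: "x \<in> plane N \<Longrightarrow> - x \<in> plane N"
  and plane_scale: "x \<in> plane N \<Longrightarrow> c *s x \<in> plane N"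
  by (simp_all add: plane_def weight_add weight_diff weight_uminus weight_scale)

lemma three_indices:
  fixes i j k :: 3
  assumes "i \<noteq> j" "j \<noteq> k" "i \<noteq> k"
  shows "UNIV = {i, j, k}"
proof -
  have "card {i, j, k} = CARD(3)" using assms by simp
  then show ?thesis by (metis card_subset_eq finite_class.finite_UNIV top_greatest)
qed

lemma all_three:
  fixes i j k :: 3
  assumes "i \<noteq> j" "j \<noteq> k" "i \<noteq> k"
  shows "(\<forall>l. Q l) \<longleftrightarrow> Q i \<and> Q j \<and> Q k"
  using three_indices[OF assms] by (metis UNIV_I empty_iff insert_iff)

lemma weight_three:
  assumes "i \<noteq> j" "j \<noteq> k" "i \<noteq> k"
  shows "weight N x = N $ i * x $ i + N $ j * x $ j + N $ k * x $ k"
  using assms by (simp add: weight_def three_indices[OF assms])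

lemma weight_mono:
  assumes "\<forall>l. N $ l > 0" "x \<le> y"
  shows "weight N x \<le> weight N y"
  using assms unfolding weight_def
  by (intro sum_mono mult_left_mono) (auto simp: less_eq_vec_def less_imp_le)

lemma third_coord_neg:
  assumes "\<forall>l. N $ l > 0" "i \<noteq> j" "j \<noteq> k" "i \<noteq> k"
    and "w \<in> plane N" "w $ i \<ge> 0" "w $ j \<ge> 0" "w $ i > 0 \<or> w $ j > 0"
  shows "w $ k < 0"
proof (rule ccontr)
  assume "\<not> w $ k < 0"
  then have "N $ k * w $ k \<ge> 0" "N $ i * w $ i \<ge> 0" "N $ j * w $ j \<ge> 0"
    using assms(1,6,7) by (simp_all add: less_imp_le)
  moreover have "N $ i * w $ i > 0 \<or> N $ j * w $ j > 0"
    using assms(1,8) by auto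
  ultimately show False
    using assms(5) by (simp add: plane_def weight_three[OF assms(2-4)])
qed

text \<open>
  What remains of a minimal Markov basis of the row vector \<open>N\<close> once ideals are replaced by walks.
\<close>

locale minimal_markov_plane =
  fixes N :: "int ^ 3" and P :: "(int ^ 3) set"
  assumes N_pos: "\<forall>l. N $ l > 0"
    and P_plane: "P \<subseteq> plane N"
    and connected: "w \<in> plane N \<Longrightarrow> (pos_part w, neg_part w) \<in> (moves P)\<^sup>*"
    and indispensable: "m \<in> P \<Longrightarrow> (pos_part m, neg_part m) \<notin> (moves (P - {m, - m}))\<^sup>*"
begin

lemma indispensable_sign:
  assumes "m \<in> P \<or> - m \<in> P"
  shows "(pos_part m, neg_part m) \<notin> (moves (P - {m, - m}))\<^sup>*"
  using assms
proof
  assume "- m \<in> P"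
  from indispensable[OF this] show ?thesis
    using walk_sym by (auto simp: insert_commute)
qed (rule indispensable)

text \<open>
  The weight is constant along a walk, and one end point of a step using \<open>\<plusminus>m\<close> dominates \<open>m\<^sup>+\<close>. In a
  fibre lighter than \<open>m\<^sup>+\<close> such steps never occur.
\<close>

lemma light_walk:
  assumes "0 \<le> x" "0 \<le> y" "x - y \<in> plane N" "weight N x < weight N (pos_part m)"
  shows "(x, y) \<in> (moves (P - {m, - m}))\<^sup>*"
proof -
  have heavy: "weight N (pos_part m) \<le> weight N a" if "0 \<le> a" "0 \<le> b" "a - b = m" for a b
    using that by (intro weight_mono N_pos) (auto simp: less_eq_vec_def)
  have "(x, y) \<in> (moves P)\<^sup>*"
    using walk_between_fibre_points[of "plane N"] connected assms(1-3) by blast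
  then have "weight N y = weight N x \<and> (x, y) \<in> (moves (P - {m, - m}))\<^sup>*"
  proof (induction rule: rtrancl_induct)
    case (step y z)
    have eq: "weight N z = weight N y"
      using step.hyps(2) P_plane weight_diff[of N y z] weight_diff[of N z y]
      by (auto simp: moves_def plane_def)
    have ne: "y - z \<noteq> m" "z - y \<noteq> m"
      using heavy[of y z] heavy[of z y] step eq assms(4) by (auto simp: moves_def)
    then have "y - z \<noteq> - m" "z - y \<noteq> - m"
      by (metis minus_diff_eq minus_minus)+
    with ne have "(y, z) \<in> moves (P - {m, - m})"
      using step.hyps(2) by (auto simp: moves_def)
    with step.IH eq show ?case by auto
  qed simp
  then show ?thesis by simp
qed

text \<open>
  Removing a common unit vector from both points leads to a lighter fibre.
\<close>

lemma shared_walk: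
  assumes "0 \<le> x" "0 \<le> y" "x - y \<in> plane N" "weight N x \<le> weight N (pos_part m)"
    and "x $ l > 0" "y $ l > 0"
  shows "(x, y) \<in> (moves (P - {m, - m}))\<^sup>*"
proof -
  define e :: "int ^ 3" where "e = axis l 1"
  have e: "0 \<le> e" "0 \<le> x - e" "0 \<le> y - e"
    using assms(1,2,5,6) by (auto simp: e_def less_eq_vec_def axis_def)
  have "weight N e = N $ l"
    by (simp add: e_def weight_def axis_def if_distrib cong: if_cong)
  then have "weight N (x - e) < weight N (pos_part m)"
    using assms(4) N_pos[rule_format, of l] by (simp add: weight_diff)
  moreover have "(x - e) - (y - e) \<in> plane N" using assms(3) by simp
  ultimately have "(x - e, y - e) \<in> (moves (P - {m, - m}))\<^sup>*"
    using e by (intro light_walk) auto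
  from walk_translate[OF this e(1)] show ?thesis by simp
qed

lemma weight_pos_neg: "m \<in> plane N \<Longrightarrow> weight N (neg_part m) = weight N (pos_part m)"
  using weight_diff[of N "pos_part m" "neg_part m"] by (simp add: plane_def)

text \<open>
  If \<open>w\<close> were smaller, then \<open>m\<^sup>+ - w\<close> would have coordinate \<open>i\<close> in common with \<open>m\<^sup>+\<close> and coordinate \<open>k\<close>
  in common with \<open>m\<^sup>-\<close>, and \<open>shared_walk\<close> would give a detour through it that avoids \<open>m\<close>.
\<close>

lemma edge_move_smallest:
  assumes "i \<noteq> j" "j \<noteq> k" "i \<noteq> k" "m \<in> P \<or> - m \<in> P" "m $ i > 0" "m $ j = 0"
    and "w \<in> plane N" "w $ j = 0" "w $ i > 0"
  shows "m $ i \<le> w $ i"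
proof (rule ccontr)
  assume less: "\<not> m $ i \<le> w $ i"
  note all = all_three[OF assms(1-3)]
  have m: "m \<in> plane N" using assms(4) P_plane plane_uminus[of "- m"] by auto
  have neg: "m $ k < 0" "w $ k < 0"
    using third_coord_neg[OF N_pos assms(1-3)] m assms(5-9) by auto
  let ?mid = "pos_part m - w"
  have mid: "0 \<le> ?mid" "?mid $ i > 0" "?mid $ k > 0"
    using less neg assms(5,6,8,9) by (auto simp: less_eq_vec_def all)
  have "(pos_part m, ?mid) \<in> (moves (P - {m, - m}))\<^sup>*"
    using mid(1,2) assms(5,7) by (intro shared_walk[where l = i]) auto
  moreover have "(?mid, neg_part m) \<in> (moves (P - {m, - m}))\<^sup>*"
  proof (rule shared_walk[where l = k])
    have eq: "?mid - neg_part m = m - w"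
      using pos_minus_neg[of m] by (simp add: algebra_simps del: pos_minus_neg)
    show "?mid - neg_part m \<in> plane N" unfolding eq by (rule plane_diff[OF m assms(7)])
    show "weight N ?mid \<le> weight N (pos_part m)"
      using assms(7) by (simp add: weight_diff plane_def)
  qed (use mid neg in auto)
  ultimately show False
    using indispensable_sign[OF assms(4)] by (meson rtrancl_trans)
qed

end

text \<open>
  The configuration that makes distance reduction fail: up to sign, \<open>P\<close> contains vectors with sign
  patterns \<open>(+, 0, -)\<close> and \<open>(0, +, -)\<close> with respect to the ordering \<open>i, j, k\<close> of the coordinates.
\<close>

locale two_edge_moves = minimal_markov_plane +
  fixes i j k :: 3 and v v' :: "int ^ 3"
  assumes ijk: "i \<noteq> j" "j \<noteq> k" "i \<noteq> k"
    and v_P: "v \<in> P \<or> - v \<in> P" and v'_P: "v' \<in> P \<or> - v' \<in> P"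
    and v_coords: "v $ i > 0" "v $ j = 0" and v'_coords: "v' $ i = 0" "v' $ j > 0"
begin

lemma v_plane: "v \<in> plane N" and v'_plane: "v' \<in> plane N"
  using v_P v'_P P_plane plane_uminus[of "- v"] plane_uminus[of "- v'"] by auto

lemmas all_ijk = all_three[OF ijk]

lemma v_k: "v $ k < 0" and v'_k: "v' $ k < 0"
  using third_coord_neg[OF N_pos ijk] v_plane v'_plane v_coords v'_coords by auto

lemma v_smallest: "w \<in> plane N \<Longrightarrow> w $ j = 0 \<Longrightarrow> w $ i > 0 \<Longrightarrow> v $ i \<le> w $ i"
  using edge_move_smallest[of i j k v w] ijk v_P v_coords by blast

lemma v'_smallest: "w \<in> plane N \<Longrightarrow> w $ i = 0 \<Longrightarrow> w $ j > 0 \<Longrightarrow> v' $ j \<le> w $ j"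
  using edge_move_smallest[of j i k v' w] ijk v'_P v'_coords by auto

text \<open>
  The reason why two moves suffice. Let \<open>w\<close> be a point of the plane in the open parallelogram. Both
  \<open>w\<close> and \<open>v + v' - w\<close> are negative only in coordinate \<open>k\<close>, and their two values there add up to
  \<open>v $ k + v' $ k\<close>. So one of the points has absolute value at coordinate \<open>k\<close> less than that of \<open>v\<close>
  or of \<open>v'\<close>, or else all four absolute values agree. In the first case the smaller point gives a
  detour from \<open>v\<^sup>+\<close> to \<open>v\<^sup>-\<close> (or from \<open>v'\<^sup>+\<close> to \<open>v'\<^sup>-\<close>) which shares a coordinate with both ends. In
  the second case \<open>v\<^sup>- = v'\<^sup>-\<close>, and the walk from \<open>v\<^sup>+\<close> through the detour to \<open>v'\<^sup>+\<close> and then along \<open>v'\<close>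
  avoids \<open>v\<close>.
\<close>

lemma no_interior_point:
  assumes w: "w \<in> plane N" "0 < w $ i" "w $ i < v $ i" "0 < w $ j" "w $ j < v' $ j"
  shows False
proof -
  have detour: "v $ k < w $ k \<longrightarrow> False" "v' $ k < w $ k \<longrightarrow> False"
      "v $ k = w $ k \<longrightarrow> v' $ k \<noteq> w $ k"
    if w: "w \<in> plane N" "0 < w $ i" "w $ i < v $ i" "0 < w $ j" "w $ j < v' $ j" for w
  proof -
    have wk: "w $ k < 0" using third_coord_neg[OF N_pos ijk w(1)] w by auto
    let ?v = "moves (P - {v, - v})" and ?v' = "moves (P - {v', - v'})"
    define x where "x = neg_part v + w"
    define x' where "x' = neg_part v' + w"
    have eq: "pos_part v - x = v - w" "x - neg_part v = w"
      "pos_part v' - x' = v' - w" "x' - neg_part v' = w"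
      using pos_minus_neg[of v] pos_minus_neg[of v']
      by (simp_all add: x_def x'_def algebra_simps del: pos_minus_neg)
    have x_plane: "pos_part v - x \<in> plane N" "x - neg_part v \<in> plane N"
      "pos_part v' - x' \<in> plane N" "x' - neg_part v' \<in> plane N"
      unfolding eq using w(1) plane_diff[OF v_plane w(1)] plane_diff[OF v'_plane w(1)] by auto
    have wx: "weight N x = weight N (pos_part v)" "weight N x' = weight N (pos_part v')"
      using w(1) weight_pos_neg[OF v_plane] weight_pos_neg[OF v'_plane]
      by (simp_all add: x_def x'_def weight_add plane_def)
    \<comment> \<open>The point \<open>x\<close> is nonnegative as soon as \<open>v $ k \<le> w $ k\<close>, and it shares coordinate \<open>i\<close> with
    \<open>v\<^sup>+\<close>. If the inequality is strict, it also shares coordinate \<open>k\<close> with \<open>v\<^sup>-\<close>.\<close>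
    have to_x: "(pos_part v, x) \<in> ?v\<^sup>*" if "v $ k \<le> w $ k"
      using that w v_coords v_k wx x_plane
      by (intro shared_walk[where l = i]) (auto simp: less_eq_vec_def all_ijk x_def)
    have to_x': "(pos_part v', x') \<in> ?v'\<^sup>*" if "v' $ k \<le> w $ k"
      using that w v'_coords v'_k wx x_plane
      by (intro shared_walk[where l = j]) (auto simp: less_eq_vec_def all_ijk x'_def)
    show "v $ k < w $ k \<longrightarrow> False"
    proof
      assume less: "v $ k < w $ k"
      have "(x, neg_part v) \<in> ?v\<^sup>*"
        using less w v_coords v_k wx x_plane
        by (intro shared_walk[where l = k]) (auto simp: less_eq_vec_def all_ijk x_def)
      with to_x less indispensable_sign[OF v_P] show False by (meson less_imp_le rtrancl_trans)
    qed
    show "v' $ k < w $ k \<longrightarrow> False"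
    proof
      assume less: "v' $ k < w $ k"
      have "(x', neg_part v') \<in> ?v'\<^sup>*"
        using less w v'_coords v'_k wx x_plane
        by (intro shared_walk[where l = k]) (auto simp: less_eq_vec_def all_ijk x'_def)
      with to_x' less indispensable_sign[OF v'_P] show False by (meson less_imp_le rtrancl_trans)
    qed
    show "v $ k = w $ k \<longrightarrow> v' $ k \<noteq> w $ k"
    proof (intro impI notI)
      assume eq: "v $ k = w $ k" "v' $ k = w $ k"
      have same: "neg_part v' = neg_part v"
        using eq v_coords v'_coords by (simp add: vec_eq_iff all_ijk)
      have "(x, pos_part v') \<in> ?v\<^sup>*"
      proof (rule shared_walk[where l = j])
        have "x - pos_part v' = w - v'"
          using pos_minus_neg[of v'] unfolding x_def same[symmetric]
          by (simp add: algebra_simps del: pos_minus_neg)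
        then show "x - pos_part v' \<in> plane N" using plane_diff[OF w(1) v'_plane] by simp
      qed (use eq w v_coords v'_coords v_k wx in \<open>auto simp: less_eq_vec_def all_ijk x_def\<close>)
      moreover have "(pos_part v', neg_part v) \<in> ?v"
      proof -
        have "v' \<noteq> v" "v' \<noteq> - v" using v_coords v'_coords by auto
        then have "v' \<in> P - {v, - v} \<or> - v' \<in> P - {v, - v}" using v'_P by auto
        moreover have "pos_part v' - neg_part v = v'" "neg_part v - pos_part v' = - v'"
          using pos_minus_neg[of v'] minus_diff_eq[of "pos_part v'" "neg_part v'"]
          unfolding same by simp_all
        ultimately show ?thesis by (auto simp: moves_def)
      qed
      ultimately have "(x, neg_part v) \<in> ?v\<^sup>*" by (rule rtrancl_into_rtrancl)
      with to_x have "(pos_part v, neg_part v) \<in> ?v\<^sup>*"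
        by (rule rtrancl_trans) (simp add: eq)
      with indispensable_sign[OF v_P] show False ..
    qed
  qed
  have "v + v' - w \<in> plane N"
    by (intro plane_add plane_diff v_plane v'_plane w)
  then show False
    using detour[of w] detour[of "v + v' - w"] w v_coords v'_coords by auto
qed

text \<open>
  Reduce coordinates \<open>i\<close> and \<open>j\<close> modulo \<open>v $ i\<close> and \<open>v' $ j\<close>. A nonzero remainder would be an
  interior point of the parallelogram or would contradict that \<open>v\<close> and \<open>v'\<close> are smallest on their edges.
\<close>

lemma plane_spanned:
  assumes "w \<in> plane N"
  obtains a b where "w = a *s v + b *s v'"
proof -
  define a b where "a = w $ i div v $ i" "b = w $ j div v' $ j"
  define r where "r = w - a *s v - b *s v'"
  have r: "r \<in> plane N"
    unfolding r_def by (intro plane_diff plane_scale assms v_plane v'_plane)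
  have "r $ i = w $ i mod v $ i" "r $ j = w $ j mod v' $ j"
    by (simp_all add: r_def a_b_def v_coords v'_coords minus_div_mult_eq_mod)
  then have bounds: "0 \<le> r $ i" "r $ i < v $ i" "0 \<le> r $ j" "r $ j < v' $ j"
    using v_coords v'_coords by simp_all
  have "\<not> (0 < r $ i \<and> 0 < r $ j)" "\<not> (r $ j = 0 \<and> 0 < r $ i)" "\<not> (r $ i = 0 \<and> 0 < r $ j)"
    using no_interior_point[OF r] v_smallest[OF r] v'_smallest[OF r] bounds by force+
  with bounds have "r $ i = 0 \<and> r $ j = 0" by linarith
  moreover from this have "r $ k = 0"
    using r N_pos[rule_format, of k] by (simp add: plane_def weight_three[OF ijk])
  ultimately have "r = 0" by (simp add: vec_eq_iff all_ijk)
  then have "w = a *s v + b *s v'" by (simp add: r_def algebra_simps)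
  then show ?thesis by (rule that)
qed

text \<open>
  Subtracting \<open>v\<close> decreases only coordinate \<open>i\<close>, and subtracting \<open>v'\<close> only coordinate \<open>j\<close>.
\<close>

lemma descend_walk:
  assumes "0 \<le> x" "int a * v $ i \<le> x $ i" "int b * v' $ j \<le> x $ j"
  shows "(x, x - int a *s v - int b *s v') \<in> (moves {v, v'})\<^sup>*"
  using assms
proof (induction "a + b" arbitrary: a b x)
  case (Suc n)
  have step: "(x, x - m) \<in> moves {v, v'}" if "0 \<le> x" "0 \<le> x - m" "m \<in> {v, v'}" for x m
    using that by (auto simp: moves_def)
  show ?case
  proof (cases a)
    case (Suc a')
    have "v $ i \<le> x $ i"
    proof -
      have "0 \<le> int a' * v $ i" using v_coords(1) by simp
      then show ?thesis using Suc.prems(2) unfolding Suc by (simp add: algebra_simps)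
    qed
    then have x': "0 \<le> x - v"
      using Suc.prems(1) v_coords v_k by (auto simp: less_eq_vec_def all_ijk)
    have "(x - v, x - v - int a' *s v - int b *s v') \<in> (moves {v, v'})\<^sup>*"
      using Suc.prems Suc.hyps(2) x' Suc v_coords
      by (intro Suc.hyps(1)) (auto simp: algebra_simps)
    moreover have "x - v - int a' *s v - int b *s v' = x - int a *s v - int b *s v'"
      by (simp add: Suc vec_eq_iff algebra_simps)
    ultimately show ?thesis
      using step[OF Suc.prems(1) x'] by (simp add: converse_rtrancl_into_rtrancl)
  next
    case 0
    then obtain b' where b: "b = Suc b'" using Suc.hyps(2) by (cases b) auto
    have "v' $ j \<le> x $ j"
    proof -
      have "0 \<le> int b' * v' $ j" using v'_coords(2) by simp
      then show ?thesis using Suc.prems(3) unfolding b by (simp add: algebra_simps)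
    qed
    then have x': "0 \<le> x - v'"
      using Suc.prems(1) v'_coords v'_k by (auto simp: less_eq_vec_def all_ijk)
    have "(x - v', x - v' - int a *s v - int b' *s v') \<in> (moves {v, v'})\<^sup>*"
      using Suc.prems Suc.hyps(2) x' b v'_coords
      by (intro Suc.hyps(1)) (auto simp: algebra_simps)
    moreover have "x - v' - int a *s v - int b' *s v' = x - int a *s v - int b *s v'"
      by (simp add: b vec_eq_iff algebra_simps)
    ultimately show ?thesis
      using step[OF Suc.prems(1) x'] by (simp add: converse_rtrancl_into_rtrancl)
  qed
qed simp

text \<open>
  Write \<open>w = a v + b v'\<close>. From \<open>w\<^sup>+\<close> subtract the terms with positive coefficient, from \<open>w\<^sup>-\<close> those with
  negative coefficient. Both walks stay nonnegative and end at the same point.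
\<close>

lemma two_moves_connect:
  assumes "w \<in> plane N"
  shows "(pos_part w, neg_part w) \<in> (moves {v, v'})\<^sup>*"
proof -
  obtain a b where w: "w = a *s v + b *s v'" using plane_spanned[OF assms] .
  let ?x = "pos_part w - int (nat a) *s v - int (nat b) *s v'"
  let ?y = "neg_part w - int (nat (- a)) *s v - int (nat (- b)) *s v'"
  have wij: "w $ i = a * v $ i" "w $ j = b * v' $ j"
    using v_coords v'_coords by (simp_all add: w)
  have "(pos_part w, ?x) \<in> (moves {v, v'})\<^sup>*"
    by (rule descend_walk) (use wij v_coords v'_coords in \<open>auto simp: max_def mult_le_0_iff\<close>)
  moreover have "(neg_part w, ?y) \<in> (moves {v, v'})\<^sup>*"
    by (rule descend_walk)
      (use wij v_coords v'_coords in \<open>auto simp: max_def zero_le_mult_iff mult_less_0_iff\<close>)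
  moreover have "?x = ?y"
  proof -
    have n: "int (nat c) - int (nat (- c)) = c" for c by simp
    have "?x - ?y = (pos_part w - neg_part w) - (int (nat a) - int (nat (- a))) *s v
        - (int (nat b) - int (nat (- b))) *s v'"
      by (simp add: vec_eq_iff algebra_simps del: nat_0_le int_nat_eq pos_minus_neg)
    also have "\<dots> = 0" unfolding n pos_minus_neg by (simp add: w)
    finally show ?thesis by simp
  qed
  ultimately show ?thesis by (metis rtrancl_trans walk_sym)
qed

text \<open>
  The parts of any further element would be connected by \<open>v\<close> and \<open>v'\<close> alone.
\<close>

lemma P_subset: "P \<subseteq> {v, - v, v', - v'}"
proof
  fix m assume m: "m \<in> P"
  show "m \<in> {v, - v, v', - v'}"
  proof (rule ccontr)
    assume "m \<notin> {v, - v, v', - v'}"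
    then have "v \<noteq> m" "v \<noteq> - m" "v' \<noteq> m" "v' \<noteq> - m" by auto
    then have "v \<in> P - {m, - m} \<or> - v \<in> P - {m, - m}" "v' \<in> P - {m, - m} \<or> - v' \<in> P - {m, - m}"
      using v_P v'_P by (metis Diff_iff empty_iff insert_iff minus_minus)+
    then have signed: "u \<in> P - {m, - m} \<or> - u \<in> P - {m, - m}" if "u \<in> {v, v'}" for u
      using that by blast
    have "moves {v, v'} \<subseteq> moves (P - {m, - m})"
    proof clarify
      fix x y assume "(x, y) \<in> moves {v, v'}"
      then have "0 \<le> x" "0 \<le> y" "x - y \<in> {v, v'} \<or> y - x \<in> {v, v'}"
        by (simp_all add: moves_def)
      then show "(x, y) \<in> moves (P - {m, - m})"
        using signed[of "x - y"] signed[of "y - x"] unfolding moves_def minus_diff_eq by blast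
    qed
    then have "(pos_part m, neg_part m) \<in> (moves (P - {m, - m}))\<^sup>*"
      using two_moves_connect[OF subsetD[OF P_plane m]] by (meson rtrancl_mono subsetD)
    then show False using indispensable[OF m] by simp
  qed
qed

end

section \<open>Complete intersections\<close>

lemma weighted_sum_1_mult:
  "weighted_sum (\<lambda>_. 1) (f * g) = weighted_sum (\<lambda>_. 1) f * weighted_sum (\<lambda>_. 1) g"
  by (induction f rule: poly_mapping_single_induct)
    (simp_all add: algebra_simps weighted_sum_add weighted_sum_single_mult)

text \<open>
  Differentiating a monomial with respect to variable \<open>i\<close> and evaluating at \<open>(1, \<dots>, 1)\<close> gives its
  exponent at \<open>i\<close>.
\<close>

definition derivative_at_ones :: "'n \<Rightarrow> ('n, 'k::comm_ring_1) mpoly \<Rightarrow> 'k" where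
  "derivative_at_ones i = weighted_sum (\<lambda>a. of_nat (Poly_Mapping.lookup a i))"

lemma derivative_at_ones_mult:
  "derivative_at_ones i (f * g) =
     weighted_sum (\<lambda>_. 1) f * derivative_at_ones i g + derivative_at_ones i f * weighted_sum (\<lambda>_. 1) g"
proof (induction f rule: poly_mapping_single_induct)
  case (single a c f)
  have "weighted_sum (\<lambda>b. of_nat (Poly_Mapping.lookup a i) + of_nat (Poly_Mapping.lookup b i)) g
      = of_nat (Poly_Mapping.lookup a i) * weighted_sum (\<lambda>_. 1) g + derivative_at_ones i g"
    by (simp add: weighted_sum_def derivative_at_ones_def algebra_simps sum.distrib sum_distrib_left)
  then show ?case
    using single unfolding derivative_at_ones_def distrib_right weighted_sum_add
      weighted_sum_single_mult weighted_sum_single lookup_add of_nat_add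
    by (simp add: algebra_simps)
qed (simp add: derivative_at_ones_def)

lemma derivative_at_ones_toric_binomial:
  "derivative_at_ones i (toric_binomial z :: ('n::finite, 'k::comm_ring_1) mpoly) = of_int (z $ i)"
proof -
  have "of_nat (nat (max x 0)) - of_nat (nat (max (- x) 0)) = (of_int x :: 'k)" for x
    by (cases "0 \<le> x") (simp_all add: max_def of_nat_nat)
  then show ?thesis
    by (simp add: derivative_at_ones_def toric_binomial_def weighted_sum_diff monomial_def)
qed

lemma weighted_sum_1_toric_binomial [simp]:
  "weighted_sum (\<lambda>_. 1) (toric_binomial z :: ('n::finite, 'k::comm_ring_1) mpoly) = 0"
  by (simp add: toric_binomial_def weighted_sum_diff monomial_def)

text \<open>
  All elements of the ideal vanish at \<open>(1, \<dots>, 1)\<close>. By the product rule, the gradient of a multiple of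
  \<open>f\<close> at that point is a multiple of the gradient of \<open>f\<close>. The gradient of a toric binomial is its
  vector, read in \<open>k\<close>.
\<close>

lemma principal_toric_ideal_minors:
  fixes A :: "int ^ 'n::finite ^ 'd"
  assumes f: "ideal_generated {f} = (toric_ideal A :: ('n, 'k::field) mpoly set)"
    and z: "z \<in> int_kernel A" "z' \<in> int_kernel A"
  shows "of_int (z $ i * z' $ j - z $ j * z' $ i) = (0 :: 'k)"
proof -
  have "toric_binomial z \<in> ideal_generated {f}" "toric_binomial z' \<in> ideal_generated {f}"
    unfolding f toric_ideal_def using z by (auto intro: ideal_base)
  then obtain g g' where g: "toric_binomial z = g * f" "toric_binomial z' = g' * f"
    by (auto simp: ideal_singleton)
  have "f \<in> toric_ideal A" by (simp add: f[symmetric] ideal_base)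
  then have "weighted_sum (\<lambda>_. 1) f = 0"
    unfolding toric_ideal_def
    by (induction rule: ideal_induct) (auto simp: weighted_sum_add weighted_sum_1_mult)
  then have "of_int (z $ l) = weighted_sum (\<lambda>_. 1) g * derivative_at_ones l f"
    "of_int (z' $ l) = weighted_sum (\<lambda>_. 1) g' * derivative_at_ones l f" for l
    using derivative_at_ones_mult[of l g f] derivative_at_ones_mult[of l g' f]
    by (simp_all add: g[symmetric] derivative_at_ones_toric_binomial)
  then show ?thesis by (simp add: algebra_simps)
qed

text \<open>
  Divide the weights by their gcd. The minors of the vectors
  \<open>(r\<^sub>j, - r\<^sub>i, 0)\<close> and \<open>(r\<^sub>k, 0, - r\<^sub>i)\<close> include \<open>r\<^sub>i\<^sup>2\<close>, so every reduced weight \<open>r\<^sub>i\<close> would vanish in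
  \<open>k\<close>. By Bezout this is impossible in every characteristic.
\<close>

lemma toric_ideal_of_plane_not_principal:
  fixes A :: "int ^ 3 ^ 'd" and f :: "(3, 'k::field) mpoly"
  assumes N: "\<forall>l. N $ l > 0" and A: "int_kernel A = plane N"
  shows "ideal_generated {f} \<noteq> toric_ideal A"
proof
  assume f: "ideal_generated {f} = toric_ideal A"
  define g where "g = gcd (N $ 1) (gcd (N $ 2) (N $ 3))"
  have "g > 0" unfolding g_def using N[rule_format, of 1] by (simp add: gcd_pos_int)
  have g_dvd: "g dvd N $ l" for l
  proof -
    have "g dvd N $ 1" and g23: "g dvd gcd (N $ 2) (N $ 3)"
      unfolding g_def by (rule gcd_dvd1, rule gcd_dvd2)
    then show ?thesis
      using exhaust_3[of l] dvd_trans[OF g23 gcd_dvd1] dvd_trans[OF g23 gcd_dvd2] by auto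
  qed
  define r where "r l = N $ l div g" for l
  have r: "N $ l = g * r l" for l using g_dvd[of l] by (simp add: r_def)
  have r0: "of_int (r i) = (0 :: 'k)" if ijk: "i \<noteq> j" "j \<noteq> k" "i \<noteq> k" for i j k
  proof -
    define z z' :: "int ^ 3"
      where "z = (\<chi> l. if l = i then r j else if l = j then - r i else 0)"
        and "z' = (\<chi> l. if l = i then r k else if l = k then - r i else 0)"
    have "z \<in> int_kernel A" "z' \<in> int_kernel A"
      using ijk by (auto simp: A plane_def weight_three[OF ijk] z_def z'_def r)
    from principal_toric_ideal_minors[OF f this, of j k]
    show ?thesis using ijk by (simp add: z_def z'_def)
  qed
  have "of_int (r l) = (0 :: 'k)" for l
    using r0[of 1 2 3] r0[of 2 1 3] r0[of 3 1 2] exhaust_3[of l] by auto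
  moreover obtain a b where "g = a * N $ 1 + b * gcd (N $ 2) (N $ 3)"
    unfolding g_def using bezout_int by metis
  moreover obtain c d where "gcd (N $ 2) (N $ 3) = c * N $ 2 + d * N $ 3"
    using bezout_int by metis
  ultimately have "g * 1 = g * (a * r 1 + b * (c * r 2 + d * r 3))"
    by (simp add: r algebra_simps)
  then have "1 = a * r 1 + b * (c * r 2 + d * r 3)" using \<open>g > 0\<close> by simp
  then have "(of_int 1 :: 'k) = of_int (a * r 1 + b * (c * r 2 + d * r 3))" by simp
  then show False using \<open>\<And>l. of_int (r l) = (0 :: 'k)\<close> by simp
qed

lemma rank_row_matrix3:
  assumes "n1 \<noteq> 0"
  shows "rank (rat_matrix (row_matrix3 n1 n2 n3)) = 1"
proof -
  have "rows (rat_matrix (row_matrix3 n1 n2 n3)) = {row 1 (rat_matrix (row_matrix3 n1 n2 n3))}"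
    by (auto simp: rows_def num1_eq1)
  moreover have "row 1 (rat_matrix (row_matrix3 n1 n2 n3)) $ 1 \<noteq> 0"
    using assms by (simp add: row_def rat_matrix_def row_matrix3_def map_matrix_def)
  then have "row 1 (rat_matrix (row_matrix3 n1 n2 n3)) \<noteq> 0" by auto
  ultimately show ?thesis by (simp add: row_rank_def_gen vec.dim_insert)
qed

lemma int_kernel_row_matrix3: "int_kernel (row_matrix3 n1 n2 n3) = plane (vector [n1, n2, n3])"
  by (auto simp: int_kernel_def plane_def weight_def row_matrix3_def matrix_vector_mult_def
      vec_eq_iff sum_3)

context two_edge_moves
begin

lemma complete_intersection:
  assumes N: "N = vector [n1, n2, n3]"
  shows "complete_intersection TYPE('k::field) (row_matrix3 n1 n2 n3)"
proof -
  let ?T = "row_matrix3 n1 n2 n3"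
  let ?I = "toric_ideal ?T :: (3, 'k) mpoly set"
  have T: "int_kernel ?T = plane N" by (simp add: int_kernel_row_matrix3 N)
  have "markov_basis TYPE('k) ?T {v, v'}"
    unfolding markov_basis_iff_walks T using v_plane v'_plane two_moves_connect by auto
  then have gen: "ideal_generated {toric_binomial v, toric_binomial v'} = ?I"
    by (simp add: markov_basis_def)
  have "v \<noteq> v'" "v \<noteq> - v'" using v_coords v'_coords by auto
  then have ne: "(toric_binomial v :: (3, 'k) mpoly) \<noteq> toric_binomial v'"
    using toric_binomial_eq_imp by blast
  have "min_num_generators ?I = 2"
    unfolding min_num_generators_def
  proof (rule Least_equality)
    show "\<exists>S. finite S \<and> card S = 2 \<and> ideal_generated S = ?I"
      using gen ne by (intro exI[of _ "{toric_binomial v, toric_binomial v'}"]) simp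
  next
    fix m assume "\<exists>S. finite S \<and> card S = m \<and> ideal_generated S = ?I"
    then obtain S where S: "finite S" "card S = m" "ideal_generated S = ?I" by blast
    show "2 \<le> m"
    proof (rule ccontr)
      assume "\<not> 2 \<le> m"
      then have "card S = 0 \<or> card S = 1" using S(2) by arith
      then consider "S = {}" | f where "S = {f}"
        using S(1) by (auto simp: card_1_singleton_iff)
      then obtain f where "ideal_generated {f} = ?I"
      proof cases
        case 1
        have "ideal_generated {0 :: (3, 'k) mpoly} = {0}" by (auto simp: ideal_singleton)
        also have "\<dots> = ?I" using S(3) by (simp add: 1 ideal_empty)
        finally show ?thesis by (rule that)
      next
        case 2
        then show ?thesis using S(3) that by blast
      qed
      then show False using toric_ideal_of_plane_not_principal[OF N_pos T] by blast
    qed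
  qed
  moreover have "n1 \<noteq> 0" using N_pos[rule_format, of 1] by (simp add: N)
  ultimately show ?thesis
    by (simp add: complete_intersection_def rank_row_matrix3)
qed

end

section \<open>Kernels and bouquets\<close>

lemma int_kernel_diff: "x \<in> int_kernel A \<Longrightarrow> y \<in> int_kernel A \<Longrightarrow> x - y \<in> int_kernel A"
  and int_kernel_add: "x \<in> int_kernel A \<Longrightarrow> y \<in> int_kernel A \<Longrightarrow> x + y \<in> int_kernel A"
  and int_kernel_zero: "0 \<in> int_kernel A"
  by (simp_all add: int_kernel_def matrix_vector_mult_diff_distrib matrix_vector_right_distrib)

lemma int_kernel_uminus: "x \<in> int_kernel A \<Longrightarrow> - x \<in> int_kernel A"
  using int_kernel_diff[OF int_kernel_zero, of x A] by simp

lemma walk_difference_in_kernel: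
  assumes "(x, y) \<in> (moves (int_kernel A))\<^sup>*"
  shows "x - y \<in> int_kernel A"
  using assms
proof (induction rule: rtrancl_induct)
  case (step y z)
  then have "y - z \<in> int_kernel A"
    using int_kernel_uminus[of "z - y" A] by (auto simp: moves_def)
  from int_kernel_add[OF step.IH this] show ?case by simp
qed (simp add: int_kernel_zero)

text \<open>
  A walk with steps in a kernel does not leave its coset.
\<close>

lemma toric_ideal_subset_imp_kernel_subset:
  fixes A :: "int ^ 'n::finite ^ 'd" and A' :: "int ^ 'n ^ 'e"
  assumes "(toric_ideal A :: ('n, 'k::field) mpoly set) \<subseteq> toric_ideal A'"
  shows "int_kernel A \<subseteq> int_kernel A'"
proof
  fix z assume "z \<in> int_kernel A"
  then have "(toric_binomial z :: ('n, 'k) mpoly) \<in> toric_ideal A"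
    unfolding toric_ideal_def by (intro ideal_base imageI)
  then have "(toric_binomial z :: ('n, 'k) mpoly) \<in> toric_ideal A'"
    using assms by blast
  then have "(pos_part z, neg_part z) \<in> (moves (int_kernel A'))\<^sup>*"
    by (simp add: toric_ideal_def toric_binomial_in_ideal_iff_walk)
  from walk_difference_in_kernel[OF this] show "z \<in> int_kernel A'" by simp
qed

lemma coprime_entries_iff: "coprime_entries c \<longleftrightarrow> (\<forall>g. (\<forall>i. g dvd c $ i) \<longrightarrow> g dvd 1)"
proof
  assume "coprime_entries c"
  then show "\<forall>g. (\<forall>i. g dvd c $ i) \<longrightarrow> g dvd 1"
    unfolding coprime_entries_def by (metis Gcd_greatest imageE)
next
  assume "\<forall>g. (\<forall>i. g dvd c $ i) \<longrightarrow> g dvd 1"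
  then have "Gcd (range (($) c)) dvd 1" by (metis Gcd_dvd rangeI)
  moreover have "0 \<le> Gcd (range (($) c))" by simp
  ultimately show "coprime_entries c" unfolding coprime_entries_def by (simp add: zdvd1_eq)
qed

lemma coprime_entries_dvd_mult:
  assumes "coprime_entries c" "\<And>i. a dvd c $ i * b"
  shows "a dvd b"
proof -
  have "a dvd Gcd ((*) b ` range (($) c))"
    using assms(2) by (intro Gcd_greatest) (auto simp: mult.commute)
  then show ?thesis using assms(1) by (simp add: Gcd_mult coprime_entries_def)
qed

lemma equiv_bouquet_equiv: "equiv UNIV (bouquet_equiv A)"
proof (rule equivI)
  show "refl (bouquet_equiv A)"
    unfolding bouquet_equiv_def
    by (rule reflI, rule CollectI, rule case_prodI, rule exI[of _ 1], rule exI[of _ "- 1"]) simp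
  show "sym (bouquet_equiv A)"
  proof (rule symI)
    fix i j assume "(i, j) \<in> bouquet_equiv A"
    then obtain a b :: rat where "a \<noteq> 0" "b \<noteq> 0"
      "\<forall>u\<in>int_kernel A. a * of_int (u $ i) + b * of_int (u $ j) = 0"
      unfolding bouquet_equiv_def by blast
    moreover from this have "\<forall>u\<in>int_kernel A. b * of_int (u $ j) + a * of_int (u $ i) = 0"
      by (simp add: add.commute)
    ultimately show "(j, i) \<in> bouquet_equiv A"
      unfolding bouquet_equiv_def by blast
  qed
  show "trans (bouquet_equiv A)"
  proof (rule transI)
    fix i j l assume "(i, j) \<in> bouquet_equiv A" "(j, l) \<in> bouquet_equiv A"
    then obtain a b c d :: rat where nz: "a \<noteq> 0" "b \<noteq> 0" "c \<noteq> 0" "d \<noteq> 0"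
      and eq: "\<And>u. u \<in> int_kernel A \<Longrightarrow> a * of_int (u $ i) + b * of_int (u $ j) = 0"
        "\<And>u. u \<in> int_kernel A \<Longrightarrow> c * of_int (u $ j) + d * of_int (u $ l) = 0"
      unfolding bouquet_equiv_def by blast
    have "(a * c) * of_int (u $ i) + (- (b * d)) * of_int (u $ l) = 0" if "u \<in> int_kernel A" for u
    proof -
      have "(a * c) * of_int (u $ i) + (- (b * d)) * of_int (u $ l)
          = c * (a * of_int (u $ i) + b * of_int (u $ j))
            - b * (c * of_int (u $ j) + d * of_int (u $ l))"
        by (simp add: algebra_simps)
      then show ?thesis using eq[OF that] by simp
    qed
    moreover have "a * c \<noteq> 0" "- (b * d) \<noteq> 0" using nz by auto
    ultimately show "(i, l) \<in> bouquet_equiv A"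
      unfolding bouquet_equiv_def by blast
  qed
qed auto

lemma bouquet_equiv_proportional:
  assumes "(i, j) \<in> bouquet_equiv A" "u \<in> int_kernel A" "w \<in> int_kernel A"
  shows "u $ i * w $ j = w $ i * u $ j"
proof -
  obtain a b :: rat where "a \<noteq> 0"
    and eq: "a * of_int (u $ i) + b * of_int (u $ j) = 0" "a * of_int (w $ i) + b * of_int (w $ j) = 0"
    using assms unfolding bouquet_equiv_def by blast
  have "a * (of_int (u $ i) * of_int (w $ j) - of_int (w $ i) * of_int (u $ j))
      = (a * of_int (u $ i) + b * of_int (u $ j)) * of_int (w $ j)
        - (a * of_int (w $ i) + b * of_int (w $ j)) * of_int (u $ j)"
    by (simp add: algebra_simps)
  then have "(of_int (u $ i * w $ j) :: rat) = of_int (w $ i * u $ j)"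
    using eq \<open>a \<noteq> 0\<close> by simp
  then show ?thesis by (simp only: of_int_eq_iff)
qed

text \<open>
  The property by which \<open>bouquet_vector\<close> is selected.
\<close>

definition encodes_bouquet ::
  "int ^ 'n::{finite,linorder} ^ 'd \<Rightarrow> 'n set \<Rightarrow> int ^ 'n::{finite,linorder} \<Rightarrow> bool" where
  "encodes_bouquet A B c \<longleftrightarrow> vec_support c = B \<and> coprime_entries c \<and> c $ Min B > 0 \<and>
     (\<forall>u\<in>int_kernel A. \<exists>m. \<forall>i\<in>B. u $ i = m * c $ i)"

text \<open>
  On a bouquet all kernel elements are proportional, so the vector is the restriction of any kernel
  element \<open>u0\<close> that does not vanish there, divided by the gcd of its entries and with the sign fixed by
  the entry at \<open>Min B\<close>.
\<close>

lemma ex1_encodes_bouquet: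
  fixes A :: "int ^ 'n::{finite,linorder} ^ 'd"
  assumes B: "B \<in> bouquets A" "\<not> free_bouquet A B"
  shows "\<exists>!c. encodes_bouquet A B c"
proof -
  obtain i0 u0 where i0: "i0 \<in> B" "u0 \<in> int_kernel A" "u0 $ i0 \<noteq> 0"
    using B(2) by (auto simp: free_bouquet_def)
  have related: "(i, j) \<in> bouquet_equiv A" if "i \<in> B" "j \<in> B" for i j
    using B(1) that equiv_bouquet_equiv[of A] unfolding bouquets_def
    by (meson quotient_eq_iff)
  have u0: "u0 $ i \<noteq> 0" if i: "i \<in> B" for i
  proof -
    obtain a b :: rat where "a \<noteq> 0" "b \<noteq> 0" "a * of_int (u0 $ i0) + b * of_int (u0 $ i) = 0"
      using related[OF i0(1) i] i0(2) unfolding bouquet_equiv_def by blast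
    then show ?thesis using i0(3) by auto
  qed
  define g where "g = Gcd (($) u0 ` B)"
  have g_dvd: "g dvd u0 $ i" if "i \<in> B" for i using that by (simp add: g_def Gcd_dvd)
  have "g \<noteq> 0" using g_dvd[OF i0(1)] i0(3) by auto
  moreover have "0 \<le> g" by (simp add: g_def)
  ultimately have "g > 0" by simp
  have MinB: "Min B \<in> B" using i0(1) by (intro Min_in) auto
  define d where "d = (if u0 $ Min B > 0 then g else - g)"
  define c where "c = (\<chi> i. if i \<in> B then u0 $ i div d else 0)"
  have d0: "d \<noteq> 0" using \<open>g > 0\<close> by (simp add: d_def)
  have c: "u0 $ i = d * c $ i" if "i \<in> B" for i
    using that g_dvd[OF that] by (simp add: c_def d_def)
  have c_out: "c $ i = 0" if "i \<notin> B" for i using that by (simp add: c_def)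
  have c_nz: "c $ i \<noteq> 0" if "i \<in> B" for i using c[OF that] u0[OF that] by auto
  have "encodes_bouquet A B c"
    unfolding encodes_bouquet_def
  proof (intro conjI ballI)
    show "vec_support c = B" using c_nz c_out by (auto simp: vec_support_def)
    show cop: "coprime_entries c"
      unfolding coprime_entries_iff
    proof (intro allI impI)
      fix h assume "\<forall>i. h dvd c $ i"
      then have "d * h dvd g"
        unfolding g_def by (intro Gcd_greatest) (auto simp: c)
      then have "d * h dvd d * 1" by (auto simp: d_def split: if_splits)
      then show "h dvd 1" using d0 by (simp only: dvd_mult_cancel_left) simp
    qed
    show "c $ Min B > 0"
      using c[OF MinB] u0[OF MinB] \<open>g > 0\<close>
      by (auto simp: d_def zero_less_mult_iff not_less le_less split: if_splits)
    fix u assume u: "u \<in> int_kernel A"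
    have ratio: "u $ i * c $ i0 = c $ i * u $ i0" if "i \<in> B" for i
      using bouquet_equiv_proportional[OF related[OF that i0(1)] u i0(2)] d0
      by (simp add: c[OF that] c[OF i0(1)])
    have "c $ i0 dvd u $ i0"
    proof (rule coprime_entries_dvd_mult[OF cop])
      show "c $ i0 dvd c $ i * u $ i0" for i
        by (cases "i \<in> B") (simp_all add: ratio[symmetric] c_out)
    qed
    then obtain m where m: "u $ i0 = m * c $ i0" by (metis dvdE mult.commute)
    have "u $ i = m * c $ i" if "i \<in> B" for i
      using ratio[OF that] c_nz[OF i0(1)] by (simp add: m)
    then show "\<exists>m. \<forall>i\<in>B. u $ i = m * c $ i" by blast
  qed
  moreover have "c1 = c2" if e: "encodes_bouquet A B c1" "encodes_bouquet A B c2" for c1 c2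
  proof -
    obtain m1 where m1: "\<forall>i\<in>B. u0 $ i = m1 * c1 $ i"
      using e(1) i0(2) by (auto simp: encodes_bouquet_def)
    obtain m2 where m2: "\<forall>i\<in>B. u0 $ i = m2 * c2 $ i"
      using e(2) i0(2) by (auto simp: encodes_bouquet_def)
    have nz: "m1 \<noteq> 0" using m1 i0(1,3) by auto
    have eq: "m1 * c1 $ i = m2 * c2 $ i" for i
    proof (cases "i \<in> B")
      case False
      then have "c1 $ i = 0" "c2 $ i = 0"
        using e by (auto simp: encodes_bouquet_def vec_support_def)
      then show ?thesis by simp
    qed (use m1 m2 in auto)
    have "m1 dvd m2" "m2 dvd m1"
      using e eq coprime_entries_dvd_mult[of c2 m1 m2] coprime_entries_dvd_mult[of c1 m2 m1]
      unfolding encodes_bouquet_def by (metis dvd_triv_left mult.commute)+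
    then have "m1 = m2 \<or> m1 = - m2" by (metis abs_eq_iff zdvd_antisym_abs)
    moreover have "m1 \<noteq> - m2"
    proof
      assume "m1 = - m2"
      then have "m1 * (c1 $ Min B + c2 $ Min B) = 0"
        using eq[of "Min B"] by (simp add: algebra_simps)
      then show False using e nz by (auto simp: encodes_bouquet_def)
    qed
    ultimately show ?thesis using eq nz by (simp add: vec_eq_iff)
  qed
  ultimately show ?thesis by blast
qed

lemma encodes_bouquet_vector:
  assumes "B \<in> bouquets A" "\<not> free_bouquet A B"
  shows "encodes_bouquet A B (bouquet_vector A B)"
proof -
  have "bouquet_vector A B = (THE c. encodes_bouquet A B c)"
    by (simp add: bouquet_vector_def encodes_bouquet_def)
  then show ?thesis using theI'[OF ex1_encodes_bouquet[OF assms]] by simp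
qed

text \<open>
  Every column index \<open>j\<close> belongs to exactly one bouquet, numbered \<open>\<beta> j\<close>. If \<open>\<gamma> j\<close> is the entry of its
  encoding vector at \<open>j\<close>, then this is the combination of the encoding vectors with coefficients \<open>w\<close>.
\<close>

definition blowup :: "('n::finite \<Rightarrow> 3) \<Rightarrow> ('n \<Rightarrow> int) \<Rightarrow> int ^ 3 \<Rightarrow> int ^ 'n" where
  "blowup \<beta> \<gamma> w = (\<chi> j. \<gamma> j * w $ \<beta> j)"

lemma blowup_nth [simp]: "blowup \<beta> \<gamma> w $ j = \<gamma> j * w $ \<beta> j"
  by (simp add: blowup_def)

text \<open>
  All that is used about robustness. The bouquet ideal determines the kernel of the bouquet matrix,
  which is therefore \<open>ker T\<close>. The entry of each encoding vector at the minimum of its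
  bouquet is positive.
\<close>

lemma robust_blowup:
  fixes A :: "int ^ 'n::{finite,linorder} ^ 'd"
  assumes "robust TYPE('k::field) T \<omega> A"
  obtains \<beta> \<gamma> where "int_kernel A = blowup \<beta> \<gamma> ` int_kernel T"
    and "\<And>j. \<gamma> j \<noteq> 0" and "\<And>l. \<exists>j. \<beta> j = l \<and> \<gamma> j > 0"
    and "\<And>l. Gcd (\<gamma> ` {j. \<beta> j = l}) = 1"
    and "\<And>l. l \<in> \<omega> \<longleftrightarrow> (\<forall>j. \<beta> j = l \<longrightarrow> \<gamma> j > 0)"
proof -
  obtain B :: "3 \<Rightarrow> 'n set" where B: "bij_betw B UNIV (bouquets A)" "\<And>l. \<not> free_bouquet A (B l)"
    "toric_ideal (bouquet_matrix A B) = (toric_ideal T :: (3, 'k) mpoly set)"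
    "\<omega> = {l. \<not> mixed_bouquet A (B l)}"
    using assms unfolding robust_def by blast
  have ker: "int_kernel (bouquet_matrix A B) = int_kernel T"
    using B(3) toric_ideal_subset_imp_kernel_subset[of T "bouquet_matrix A B", where ?'k = 'k]
      toric_ideal_subset_imp_kernel_subset[of "bouquet_matrix A B" T, where ?'k = 'k] by auto
  have Bb: "B l \<in> bouquets A" for l using B(1) by (auto simp: bij_betw_def)
  define c where "c l = bouquet_vector A (B l)" for l
  have c: "encodes_bouquet A (B l) (c l)" for l
    unfolding c_def by (rule encodes_bouquet_vector[OF Bb B(2)])
  have "\<exists>l. j \<in> B l" for j
  proof -
    have "bouquet_equiv A `` {j} \<in> bouquets A" by (auto simp: bouquets_def intro: quotientI)
    then obtain l where "B l = bouquet_equiv A `` {j}"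
      using bij_betw_imp_surj_on[OF B(1)] by (metis rangeE)
    then show ?thesis using equiv_class_self[OF equiv_bouquet_equiv, of j A] by auto
  qed
  then obtain \<beta> where \<beta>: "\<And>j. j \<in> B (\<beta> j)" by metis
  have \<beta>_eq: "\<beta> j = l" if "j \<in> B l" for j l
  proof -
    have "B l = B (\<beta> j)"
      using quotient_disj[OF equiv_bouquet_equiv[of A], of "B l" "B (\<beta> j)"] Bb that \<beta>[of j]
      unfolding bouquets_def by blast
    then show ?thesis using B(1) by (auto simp: bij_betw_def inj_def)
  qed
  have mem: "j \<in> B l \<longleftrightarrow> \<beta> j = l" for j l using \<beta> \<beta>_eq by auto
  define \<gamma> where "\<gamma> j = c (\<beta> j) $ j" for j
  have supp: "c l $ j \<noteq> 0 \<longleftrightarrow> \<beta> j = l" for l j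
    using c[of l] mem[of j l] by (auto simp: encodes_bouquet_def vec_support_def)
  have c_eq: "c l $ j = (if \<beta> j = l then \<gamma> j else 0)" for l j
    using supp[of l j] by (auto simp: \<gamma>_def)
  have Min_mem: "\<beta> (Min (B l)) = l" for l
    using c[of l] supp[of l "Min (B l)"] by (auto simp: encodes_bouquet_def)
  have mult: "A *v blowup \<beta> \<gamma> w = bouquet_matrix A B *v w" for w
  proof -
    have "(\<Sum>j\<in>UNIV. A $ r $ j * (\<gamma> j * w $ \<beta> j))
        = (\<Sum>l\<in>UNIV. (\<Sum>j\<in>UNIV. A $ r $ j * c l $ j) * w $ l)" for r
    proof -
      have "(\<Sum>l\<in>UNIV. (\<Sum>j\<in>UNIV. A $ r $ j * c l $ j) * w $ l)
          = (\<Sum>j\<in>UNIV. \<Sum>l\<in>UNIV. A $ r $ j * c l $ j * w $ l)"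
        by (subst sum.swap) (simp add: sum_distrib_right)
      also have "\<dots> = (\<Sum>j\<in>UNIV. \<Sum>l\<in>UNIV. if \<beta> j = l then A $ r $ j * \<gamma> j * w $ l else 0)"
        by (intro sum.cong refl) (simp add: c_eq)
      finally show ?thesis by (simp add: mult.assoc)
    qed
    then show ?thesis
      by (simp add: matrix_vector_mult_def bouquet_matrix_def vec_eq_iff c_def)
  qed
  have blowup_kernel: "blowup \<beta> \<gamma> w \<in> int_kernel A \<longleftrightarrow> w \<in> int_kernel T" for w
    unfolding ker[symmetric] by (simp add: int_kernel_def mult)
  have kernel: "int_kernel A = blowup \<beta> \<gamma> ` int_kernel T"
  proof (intro equalityI subsetI)
    fix u assume u: "u \<in> int_kernel A"
    then have "\<forall>l. \<exists>m. \<forall>j\<in>B l. u $ j = m * c l $ j"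
      using c by (simp add: encodes_bouquet_def)
    then obtain m where m: "\<And>l j. j \<in> B l \<Longrightarrow> u $ j = m l * c l $ j" by metis
    have "u = blowup \<beta> \<gamma> (\<chi> l. m l)"
      using m[OF \<beta>] by (simp add: vec_eq_iff \<gamma>_def mult.commute)
    then show "u \<in> blowup \<beta> \<gamma> ` int_kernel T"
      using u blowup_kernel by (metis imageI)
  next
    fix u assume "u \<in> blowup \<beta> \<gamma> ` int_kernel T"
    then show "u \<in> int_kernel A" using blowup_kernel by auto
  qed
  show ?thesis
  proof (rule that[OF kernel])
    show nz: "\<gamma> j \<noteq> 0" for j using supp[of "\<beta> j" j] by (simp add: \<gamma>_def)
    show "\<exists>j. \<beta> j = l \<and> \<gamma> j > 0" for l
      using c[of l] Min_mem[of l] by (auto simp: encodes_bouquet_def \<gamma>_def)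
    show "Gcd (\<gamma> ` {j. \<beta> j = l}) = 1" for l
    proof -
      have "Gcd (\<gamma> ` {j. \<beta> j = l}) dvd c l $ j" for j
        by (cases "\<beta> j = l") (auto simp: c_eq intro: Gcd_dvd)
      then have "Gcd (\<gamma> ` {j. \<beta> j = l}) dvd 1"
        using c[of l] by (simp only: encodes_bouquet_def coprime_entries_iff) blast
      moreover have "0 \<le> Gcd (\<gamma> ` {j. \<beta> j = l})" by simp
      ultimately show ?thesis by (simp add: zdvd1_eq)
    qed
    show "l \<in> \<omega> \<longleftrightarrow> (\<forall>j. \<beta> j = l \<longrightarrow> \<gamma> j > 0)" for l
    proof -
      have "l \<in> \<omega> \<longleftrightarrow> (\<forall>j. \<not> c l $ j < 0)"
        by (simp add: B(4) mixed_bouquet_def c_def)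
      also have "\<dots> \<longleftrightarrow> (\<forall>j. \<beta> j = l \<longrightarrow> \<gamma> j > 0)"
        using nz by (auto simp: c_eq not_less less_le)
      finally show ?thesis .
    qed
  qed
qed

section \<open>Distance reduction for vectors with entry sum zero\<close>

text \<open>
  Kernel elements are orthogonal to all rows, hence to the all-ones vector in their span.
\<close>

lemma homogeneous_kernel_sum_zero:
  fixes A :: "int ^ 'n::finite ^ 'd::finite"
  assumes "homogeneous_matrix A" "u \<in> int_kernel A"
  shows "(\<Sum>j\<in>UNIV. u $ j) = 0"
proof -
  have "(\<Sum>j\<in>UNIV. y $ j * of_int (u $ j)) = 0" if "y \<in> vec.span (rows (rat_matrix A))" for y
    using that
  proof (induction rule: vec.span_induct_alt)
    case (step c x y)
    then obtain r where x: "x = row r (rat_matrix A)" by (auto simp: rows_def)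
    have "(\<Sum>j\<in>UNIV. A $ r $ j * u $ j) = 0"
      using assms(2) by (simp add: int_kernel_def matrix_vector_mult_def vec_eq_iff)
    from arg_cong[OF this, of rat_of_int]
    have "(\<Sum>j\<in>UNIV. x $ j * of_int (u $ j)) = 0"
      by (simp add: x row_def rat_matrix_def map_matrix_def)
    moreover have "(\<Sum>j\<in>UNIV. (c *s x + y) $ j * of_int (u $ j))
        = c * (\<Sum>j\<in>UNIV. x $ j * of_int (u $ j)) + (\<Sum>j\<in>UNIV. y $ j * of_int (u $ j))"
      by (simp add: algebra_simps sum.distrib sum_distrib_left)
    ultimately show ?case using step by simp
  qed simp
  from this[OF assms(1)[unfolded homogeneous_matrix_def]]
  have "rat_of_int (\<Sum>j\<in>UNIV. u $ j) = 0" by simp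
  then show ?thesis by (simp only: of_int_eq_0_iff)
qed

text \<open>
  In every coordinate \<open>\<bar>b - a\<bar> \<le> \<bar>b\<bar> - a\<close>, strictly iff both entries are negative. Summing gives the
  claim because the entries of \<open>a\<close> add up to zero.
\<close>

lemma norm1_diff_less_iff:
  assumes "(\<Sum>j\<in>UNIV. a $ j) = 0" "pos_part a \<le> pos_part b"
  shows "norm1 (b - a) < norm1 b \<longleftrightarrow> (\<exists>j. a $ j < 0 \<and> b $ j < 0)"
proof -
  have le: "\<bar>(b - a) $ j\<bar> \<le> \<bar>b $ j\<bar> - a $ j"
    and less: "\<bar>(b - a) $ j\<bar> < \<bar>b $ j\<bar> - a $ j \<longleftrightarrow> a $ j < 0 \<and> b $ j < 0" for j
    using assms(2)[unfolded less_eq_vec_def, rule_format, of j] by (auto simp: max_def split: if_splits)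
  have norm: "norm1 b = (\<Sum>j\<in>UNIV. \<bar>b $ j\<bar> - a $ j)"
    by (simp add: norm1_def sum_subtractf assms(1))
  show ?thesis
  proof
    assume ex: "\<exists>j. a $ j < 0 \<and> b $ j < 0"
    show "norm1 (b - a) < norm1 b"
      unfolding norm unfolding norm1_def
      by (rule sum_strict_mono_ex1) (use ex le less in auto)
  next
    assume "norm1 (b - a) < norm1 b"
    then show "\<exists>j. a $ j < 0 \<and> b $ j < 0"
      unfolding norm unfolding norm1_def using less
      by (metis (no_types, lifting) not_le sum_mono)
  qed
qed

lemma distance_reduced_by_iff:
  assumes "(\<Sum>j\<in>UNIV. m $ j) = 0"
  shows "distance_reduced_by z m \<longleftrightarrow>
    (\<exists>a\<in>{m, - m}. \<exists>b\<in>{z, - z}. pos_part a \<le> pos_part b \<and> (\<exists>j. a $ j < 0 \<and> b $ j < 0))"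
proof -
  have s: "1 *s x = x" "(- 1) *s x = - x" for x :: "int ^ 'a" by (simp_all add: vec_eq_iff)
  have n: "norm1 z = norm1 b" if "b \<in> {z, - z}" for b using that by (auto simp: norm1_def)
  have "distance_reduced_by z m \<longleftrightarrow>
    (\<exists>a\<in>{m, - m}. \<exists>b\<in>{z, - z}. pos_part a \<le> pos_part b \<and> norm1 (b - a) < norm1 z)"
    unfolding distance_reduced_by_def by (simp only: bex_simps(5) s) simp
  also have "\<dots> \<longleftrightarrow>
    (\<exists>a\<in>{m, - m}. \<exists>b\<in>{z, - z}. pos_part a \<le> pos_part b \<and> (\<exists>j. a $ j < 0 \<and> b $ j < 0))"
  proof (intro bex_cong refl conj_cong)
    fix a b assume ab: "a \<in> {m, - m}" "b \<in> {z, - z}" "pos_part a \<le> pos_part b"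
    have "(\<Sum>j\<in>UNIV. a $ j) = 0" using ab(1) assms by (auto simp: sum_negf)
    from norm1_diff_less_iff[OF this ab(3)] n[OF ab(2)]
    show "norm1 (b - a) < norm1 z \<longleftrightarrow> (\<exists>j. a $ j < 0 \<and> b $ j < 0)" by simp
  qed
  finally show ?thesis .
qed

section \<open>Vectors of the plane with a zero coordinate\<close>

lemma plane_signs:
  assumes N: "\<forall>l. N $ l > 0" and w: "w \<in> plane N" "w \<noteq> 0"
  obtains i where "w $ i > 0"
proof (rule ccontr)
  assume "\<not> thesis"
  then have le: "w $ l \<le> 0" for l using that by (meson not_le)
  have "(\<Sum>l\<in>UNIV. N $ l * - (w $ l)) = 0"
    using w(1) by (simp add: plane_def weight_def sum_negf)
  moreover have "0 \<le> N $ l * - (w $ l)" for l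
    using le[of l] N by (intro mult_nonneg_nonneg) (auto simp: less_imp_le)
  ultimately have "N $ l * - (w $ l) = 0" for l
    by (subst (asm) sum_nonneg_eq_0_iff) auto
  moreover have "N $ l \<noteq> 0" for l using N by (metis less_irrefl)
  ultimately have "w = 0" by (simp add: vec_eq_iff)
  then show False using w(2) by simp
qed

lemma plane_signs_neg:
  assumes N: "\<forall>l. N $ l > 0" and w: "w \<in> plane N" "w \<noteq> 0"
  obtains i where "w $ i < 0"
proof -
  obtain i where "(- w) $ i > 0"
    using plane_signs[OF N plane_uminus[OF w(1)]] w(2) by auto
  then show ?thesis using that by simp
qed

lemma plane_two_zeros:
  assumes "\<forall>l. N $ l > 0" "i \<noteq> j" "j \<noteq> k" "i \<noteq> k" "w \<in> plane N" "w $ i = 0" "w $ j = 0"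
  shows "w = 0"
proof -
  have "w $ k = 0"
    using assms(1)[rule_format, of k] assms(5-7) by (simp add: plane_def weight_three[OF assms(2-4)])
  then show ?thesis using assms(6,7) by (simp add: vec_eq_iff all_three[OF assms(2-4)])
qed

text \<open>
  The generator is \<open>(N\<^sub>j, - N\<^sub>i) / gcd N\<^sub>i N\<^sub>j\<close> at the coordinates \<open>i, j\<close>.
\<close>

lemma edge_generator:
  assumes N: "\<forall>l. N $ l > 0" and ijk: "i \<noteq> j" "j \<noteq> k" "i \<noteq> k"
  obtains c where "c \<in> plane N" "c $ i > 0" "c $ k = 0" "coprime_entries c"
    and "\<And>w. w \<in> plane N \<Longrightarrow> w $ k = 0 \<Longrightarrow> \<exists>t. w = t *s c"
proof -
  define g a b where "g = gcd (N $ i) (N $ j)" and "a = N $ i div g" and "b = N $ j div g"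
  have pos: "N $ i > 0" "N $ j > 0" using N by auto
  have "g > 0" unfolding g_def using pos by (simp add: gcd_pos_int)
  have Nij: "N $ i = g * a" "N $ j = g * b" by (simp_all add: a_def b_def g_def)
  have ab: "a > 0" "b > 0" using pos \<open>g > 0\<close> by (simp_all add: Nij zero_less_mult_iff)
  have cop: "coprime a b"
    unfolding a_def b_def g_def using pos by (intro div_gcd_coprime) auto
  define c :: "int ^ 3" where "c = (\<chi> l. if l = i then b else if l = j then - a else 0)"
  have c: "c $ i = b" "c $ j = - a" "c $ k = 0" using ijk by (simp_all add: c_def)
  show ?thesis
  proof (rule that[of c])
    show "c \<in> plane N" by (simp add: plane_def weight_three[OF ijk] c Nij)
    show "coprime_entries c"
      unfolding coprime_entries_iff using cop c by (metis coprime_common_divisor dvd_minus_iff)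
    fix w assume w: "w \<in> plane N" "w $ k = 0"
    have "g * (a * w $ i + b * w $ j) = 0"
      using w by (simp add: plane_def weight_three[OF ijk] Nij algebra_simps)
    then have eq: "a * w $ i = b * (- w $ j)" using \<open>g > 0\<close> by simp
    then have "b dvd a * w $ i" by simp
    then have "b dvd w $ i" using cop by (simp add: coprime_dvd_mult_right_iff coprime_commute)
    then obtain t where t: "w $ i = b * t" by blast
    then have "b * (a * t + w $ j) = 0" using eq by (simp add: algebra_simps)
    then have "w $ j = - (a * t)" using ab by simp
    then have "w = t *s c" using t w(2) by (simp add: vec_eq_iff all_three[OF ijk] c)
    then show "\<exists>t. w = t *s c" by blast
  qed (use c ab in auto)
qed

lemma coprime_scale_unit:
  assumes "coprime_entries (t *s w)"
  shows "t = 1 \<or> t = - 1"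
proof -
  have "t dvd 1" using assms unfolding coprime_entries_iff by simp
  then show ?thesis by (auto simp: zdvd1_eq abs_if split: if_splits)
qed

lemma coprime_entries_uminus [simp]: "coprime_entries (- c) \<longleftrightarrow> coprime_entries c"
  unfolding coprime_entries_iff by simp

text \<open>
  A nonzero vector of the plane has a positive and a negative coordinate, so two is the smallest size of
  a support, and every pair of coordinates is the support of some vector of the plane.
\<close>

lemma support_minimal_iff_zero_coordinate:
  assumes N: "\<forall>l. N $ l > 0" and u: "u \<in> plane N" "u \<noteq> 0"
  shows "(\<forall>w\<in>plane N. w \<noteq> 0 \<longrightarrow> \<not> vec_support w \<subset> vec_support u) \<longleftrightarrow> (\<exists>l. u $ l = 0)"
proof
  assume min: "\<forall>w\<in>plane N. w \<noteq> 0 \<longrightarrow> \<not> vec_support w \<subset> vec_support u"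
  show "\<exists>l. u $ l = 0"
  proof (rule ccontr)
    assume "\<not> (\<exists>l. u $ l = 0)"
    then have "vec_support u = UNIV" by (auto simp: vec_support_def)
    moreover obtain c where "c \<in> plane N" "c $ 1 > 0" "c $ 3 = 0"
      using edge_generator[OF N, of 1 2 3] by auto
    moreover from this have "c \<noteq> 0" "3 \<notin> vec_support c" by (auto simp: vec_support_def)
    ultimately show False using min by blast
  qed
next
  assume "\<exists>l. u $ l = 0"
  then obtain l where l: "u $ l = 0" by blast
  show "\<forall>w\<in>plane N. w \<noteq> 0 \<longrightarrow> \<not> vec_support w \<subset> vec_support u"
  proof (intro ballI impI notI)
    fix w assume w: "w \<in> plane N" "w \<noteq> 0" and sub: "vec_support w \<subset> vec_support u"
    obtain i where i: "w $ i > 0" using plane_signs[OF N w] .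
    obtain j where j: "w $ j < 0" using plane_signs_neg[OF N w] .
    have w_ij: "{i, j} \<subseteq> vec_support w" using i j by (auto simp: vec_support_def)
    then have "i \<in> vec_support u" "j \<in> vec_support u" using sub by auto
    then have ijl: "i \<noteq> j" "j \<noteq> l" "i \<noteq> l" using i j l by (auto simp: vec_support_def)
    have "vec_support u \<subseteq> {i, j}" using three_indices[OF ijl] l by (auto simp: vec_support_def)
    then show False using w_ij sub by blast
  qed
qed

section \<open>Vectors that are not distance-reduced\<close>

lemma walk_first_step:
  assumes "(x, y) \<in> (moves S)\<^sup>*" "x \<noteq> y"
  shows "\<exists>m. (m \<in> S \<or> - m \<in> S) \<and> m \<noteq> 0 \<and> pos_part m \<le> x"
  using assms
proof (induction rule: converse_rtrancl_induct)
  case (step x x')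
  show ?case
  proof (cases "x = x'")
    case False
    have "pos_part (x - x') \<le> x" "x - x' \<in> S \<or> - (x - x') \<in> S"
      using step.hyps(1) by (auto simp: moves_def less_eq_vec_def)
    then show ?thesis using False by (intro exI[of _ "x - x'"]) auto
  qed (use step in auto)
qed simp

lemma blowup_diff: "blowup \<beta> \<gamma> (x - y) = blowup \<beta> \<gamma> x - blowup \<beta> \<gamma> y"
  and blowup_add: "blowup \<beta> \<gamma> (x + y) = blowup \<beta> \<gamma> x + blowup \<beta> \<gamma> y"
  and blowup_uminus: "blowup \<beta> \<gamma> (- x) = - blowup \<beta> \<gamma> x"
  and blowup_zero: "blowup \<beta> \<gamma> 0 = 0"
  by (simp_all add: vec_eq_iff algebra_simps)

text \<open>
  The data extracted from the hypotheses of the theorem, free of polynomials and bouquets.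
\<close>

locale robust_markov =
  fixes A :: "int ^ 'n::finite ^ 'd" and N :: "int ^ 3"
    and \<beta> :: "'n \<Rightarrow> 3" and \<gamma> :: "'n \<Rightarrow> int" and \<omega> :: "3 set" and M :: "(int ^ 'n) set"
  assumes N_pos: "\<forall>l. N $ l > 0"
    and kernel: "int_kernel A = blowup \<beta> \<gamma> ` plane N"
    and \<gamma>_nz: "\<And>j. \<gamma> j \<noteq> 0"
    and \<gamma>_pos: "\<And>l. \<exists>j. \<beta> j = l \<and> \<gamma> j > 0"
    and \<gamma>_coprime: "\<And>l. Gcd (\<gamma> ` {j. \<beta> j = l}) = 1"
    and \<omega>_iff: "\<And>l. l \<in> \<omega> \<longleftrightarrow> (\<forall>j. \<beta> j = l \<longrightarrow> \<gamma> j > 0)"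
    and sum_zero: "\<And>u. u \<in> int_kernel A \<Longrightarrow> (\<Sum>j\<in>UNIV. u $ j) = 0"
    and M_kernel: "M \<subseteq> int_kernel A"
    and M_connects: "\<And>z. z \<in> int_kernel A \<Longrightarrow> (pos_part z, neg_part z) \<in> (moves M)\<^sup>*"
    and M_indispensable: "\<And>m. m \<in> M \<Longrightarrow> (pos_part m, neg_part m) \<notin> (moves (M - {m, - m}))\<^sup>*"
begin

abbreviation "D \<equiv> blowup \<beta> \<gamma>"

lemma D_inj: "D x = D y \<Longrightarrow> x = y"
proof -
  assume eq: "D x = D y"
  have "x $ l = y $ l" for l
  proof -
    obtain j where "\<beta> j = l" using \<gamma>_pos by blast
    then show ?thesis using arg_cong[OF eq, of "\<lambda>z. z $ j"] \<gamma>_nz[of j] by simp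
  qed
  then show ?thesis by (simp add: vec_eq_iff)
qed

lemma D_eq_iff [simp]: "D x = D y \<longleftrightarrow> x = y"
  using D_inj by blast

lemma D_eq_0_iff [simp]: "D x = 0 \<longleftrightarrow> x = 0"
  using D_inj[of x 0] by (auto simp: blowup_zero)

lemma D_kernel_iff [simp]: "D x \<in> int_kernel A \<longleftrightarrow> x \<in> plane N"
  by (auto simp: kernel)

lemma signed_M_kernel: "m \<in> M \<or> - m \<in> M \<Longrightarrow> m \<in> int_kernel A"
  using M_kernel int_kernel_uminus[of "- m" A] by auto

text \<open>
  By symmetry the sign of the element of \<open>M\<close> can be absorbed into \<open>m\<close>.
\<close>

lemma M_reduces_iff:
  "distance_reduces M z \<longleftrightarrow>
    (\<exists>m. (m \<in> M \<or> - m \<in> M) \<and>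
      (\<exists>b\<in>{z, - z}. pos_part m \<le> pos_part b \<and> (\<exists>j. m $ j < 0 \<and> b $ j < 0)))"
proof -
  have "distance_reduced_by z m \<longleftrightarrow>
    (\<exists>a\<in>{m, - m}. \<exists>b\<in>{z, - z}. pos_part a \<le> pos_part b \<and> (\<exists>j. a $ j < 0 \<and> b $ j < 0))"
    if "m \<in> M" for m
    using that M_kernel by (intro distance_reduced_by_iff sum_zero) auto
  then show ?thesis unfolding distance_reduces_def
    by (metis insertCI insertE minus_minus singletonD)
qed

lemma M_reduces_uminus [simp]: "distance_reduces M (- z) \<longleftrightarrow> distance_reduces M z"
  unfolding M_reduces_iff by (simp add: disj_commute)

text \<open>
  The move is the first step of a walk from \<open>z\<^sup>+\<close> to \<open>z\<^sup>-\<close>, where \<open>z = D u\<close>. Since it does not reduce \<open>z\<close>,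
  it has no negative coordinate in common with \<open>z\<close>. The encoding vector of a mixed bouquet has
  entries of both signs, so there a nonzero coordinate of \<open>v\<close> would produce a common
  positive and a common negative coordinate.
\<close>

lemma unreduced_first_step:
  assumes u: "u \<in> plane N" "u \<noteq> 0" and unred: "\<not> distance_reduces M (D u)"
  obtains v where "v \<in> plane N" "v \<noteq> 0" "D v \<in> M \<or> - D v \<in> M"
    and "\<And>l. v $ l > 0 \<Longrightarrow> u $ l > 0" "\<And>l. v $ l < 0 \<Longrightarrow> u $ l \<ge> 0"
    and "\<And>l. v $ l \<noteq> 0 \<Longrightarrow> l \<in> \<omega>"
proof -
  have "(pos_part (D u), neg_part (D u)) \<in> (moves M)\<^sup>*" using u by (intro M_connects) simp
  moreover have "pos_part (D u) \<noteq> neg_part (D u)"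
    using pos_minus_neg[of "D u"] u(2) by (auto simp del: pos_minus_neg)
  ultimately obtain m where m: "m \<in> M \<or> - m \<in> M" "m \<noteq> 0" "pos_part m \<le> pos_part (D u)"
    using walk_first_step by blast
  obtain v where v: "v \<in> plane N" "m = D v" using signed_M_kernel[OF m(1)] by (auto simp: kernel)
  have pos: "D u $ j > 0" if "m $ j > 0" for j
    using m(3)[unfolded less_eq_vec_def, rule_format, of j] that by (auto simp: max_def split: if_splits)
  have neg: "D u $ j \<ge> 0" if "m $ j < 0" for j
    using unred that m unfolding M_reduces_iff by (metis insertI1 not_le)
  show ?thesis
  proof (rule that[OF v(1)])
    show "v \<noteq> 0" "D v \<in> M \<or> - D v \<in> M" using m v by auto
    show P: "u $ l > 0" if "v $ l > 0" for l
    proof -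
      obtain j where "\<beta> j = l" "\<gamma> j > 0" using \<gamma>_pos by blast
      then show ?thesis using pos[of j] that by (simp add: v zero_less_mult_iff)
    qed
    show Q: "u $ l \<ge> 0" if "v $ l < 0" for l
    proof -
      obtain j where "\<beta> j = l" "\<gamma> j > 0" using \<gamma>_pos by blast
      then show ?thesis using neg[of j] that by (simp add: v mult_less_0_iff zero_le_mult_iff)
    qed
    show "l \<in> \<omega>" if "v $ l \<noteq> 0" for l
    proof (rule ccontr)
      assume "l \<notin> \<omega>"
      then obtain j where j: "\<beta> j = l" "\<gamma> j < 0"
        using \<omega>_iff \<gamma>_nz by (metis not_less_iff_gr_or_eq)
      show False
      proof (cases "v $ l > 0")
        case True
        then show False using j neg[of j] P by (simp add: v mult_less_0_iff zero_le_mult_iff) fastforce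
      next
        case False
        then have "v $ l < 0" using that by simp
        then show False using j pos[of j] Q by (simp add: v zero_less_mult_iff) fastforce
      qed
    qed
  qed
qed

text \<open>
  Apply \<open>unreduced_first_step\<close> to \<open>u\<close> and to \<open>- u\<close>. A positive coordinate \<open>i\<close> of \<open>v\<close> lies where \<open>u\<close> is
  positive, and there \<open>v'\<close> must vanish; symmetrically for a positive coordinate \<open>j\<close> of \<open>v'\<close>.
  Both vectors are then negative at the third coordinate \<open>k\<close>, which forces \<open>u $ k \<ge> 0\<close> and \<open>u $ k \<le> 0\<close>.
\<close>

lemma unreduced_edge:
  assumes u: "u \<in> plane N" "u \<noteq> 0" and unred: "\<not> distance_reduces M (D u)"
  obtains i j k v v' where "\<omega> = UNIV" "i \<noteq> j" "j \<noteq> k" "i \<noteq> k" "u $ k = 0"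
    and "D v \<in> M \<or> - D v \<in> M" "D v' \<in> M \<or> - D v' \<in> M"
    and "v $ i > 0" "v $ j = 0" "v $ k < 0" "v' $ i = 0" "v' $ j > 0" "v' $ k < 0"
proof -
  obtain v where v: "v \<in> plane N" "v \<noteq> 0" "D v \<in> M \<or> - D v \<in> M"
    "\<And>l. v $ l > 0 \<Longrightarrow> u $ l > 0" "\<And>l. v $ l < 0 \<Longrightarrow> u $ l \<ge> 0" "\<And>l. v $ l \<noteq> 0 \<Longrightarrow> l \<in> \<omega>"
    using unreduced_first_step[OF u unred] by blast
  have u': "- u \<in> plane N" "- u \<noteq> 0" "\<not> distance_reduces M (D (- u))"
    using u unred by (auto simp: plane_uminus blowup_uminus)
  obtain v' where v': "v' \<in> plane N" "v' \<noteq> 0" "D v' \<in> M \<or> - D v' \<in> M"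
    "\<And>l. v' $ l > 0 \<Longrightarrow> (- u) $ l > 0" "\<And>l. v' $ l < 0 \<Longrightarrow> (- u) $ l \<ge> 0"
    "\<And>l. v' $ l \<noteq> 0 \<Longrightarrow> l \<in> \<omega>"
    using unreduced_first_step[OF u'] by blast
  obtain i where i: "v $ i > 0" using plane_signs[OF N_pos v(1,2)] .
  obtain j where j: "v' $ j > 0" using plane_signs[OF N_pos v'(1,2)] .
  have ui: "u $ i > 0" and uj: "u $ j < 0" using v(4)[OF i] v'(4)[OF j] by simp_all
  have vj: "v $ j = 0" using v(4,5)[of j] uj by fastforce
  have v'i: "v' $ i = 0" using v'(4,5)[of i] ui by fastforce
  have "i \<noteq> j" using ui uj by auto
  moreover obtain k where "k \<noteq> i" "k \<noteq> j"
  proof -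
    have "card {i, j} \<noteq> CARD(3)" using \<open>i \<noteq> j\<close> by simp
    then have "{i, j} \<noteq> UNIV" by auto
    then show ?thesis using that by blast
  qed
  ultimately have ijk: "i \<noteq> j" "j \<noteq> k" "i \<noteq> k" by auto
  have vk: "v $ k < 0" "v' $ k < 0"
    using third_coord_neg[OF N_pos ijk v(1)] third_coord_neg[OF N_pos ijk v'(1)] i j vj v'i by auto
  have uk: "u $ k = 0" using v(5)[OF vk(1)] v'(5)[OF vk(2)] by simp
  have "\<omega> = UNIV"
    using v(6)[of i] v'(6)[of j] v(6)[of k] i j vk three_indices[OF ijk] by auto
  then show ?thesis by (rule that[OF _ ijk uk v(3) v'(3) i vj vk(1) v'i j vk(2)])
qed

end

section \<open>Transfer to the plane when no bouquet is mixed\<close>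

text \<open>
  Without mixed bouquets all entries \<open>\<gamma> j\<close> are positive. Then \<open>D\<close> is an order embedding that commutes with
  positive and negative parts, and so it maps the walks in the plane onto the walks for \<open>A\<close>.
\<close>

locale nonmixed_robust_markov = robust_markov +
  assumes \<omega>_UNIV: "\<omega> = UNIV"
begin

lemma \<gamma>_gt_0 [simp]: "\<gamma> j > 0" and \<gamma>_ge_0 [simp]: "\<gamma> j \<ge> 0"
  and \<gamma>_not_le_0 [simp]: "\<not> \<gamma> j \<le> 0" and \<gamma>_not_less_0 [simp]: "\<not> \<gamma> j < 0"
  using \<omega>_iff[of "\<beta> j"] \<omega>_UNIV by (auto simp: less_imp_le not_le not_less)

lemma pos_part_D: "pos_part (D x) = D (pos_part x)"
  and neg_part_D: "neg_part (D x) = D (neg_part x)"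
  by (auto simp: vec_eq_iff max_def mult_le_0_iff zero_le_mult_iff)

lemma D_le_iff: "D x \<le> D y \<longleftrightarrow> x \<le> y"
proof
  assume le: "D x \<le> D y"
  have "x $ l \<le> y $ l" for l
  proof -
    obtain j where "\<beta> j = l" using \<gamma>_pos by blast
    then show ?thesis
      using le[unfolded less_eq_vec_def, rule_format, of j] by (simp add: mult_le_cancel_left)
  qed
  then show "x \<le> y" by (simp add: less_eq_vec_def)
qed (simp add: less_eq_vec_def mult_left_mono)

lemma D_nonneg_iff: "0 \<le> D x \<longleftrightarrow> 0 \<le> x"
  using D_le_iff[of 0 x] by (simp add: blowup_zero)

text \<open>
  The set \<open>M\<close> seen in the plane; it is a minimal Markov basis there by the sublocale relation below.
\<close>

definition P :: "(int ^ 3) set" where "P = {w. D w \<in> M}"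

lemma P_signed_iff: "w \<in> P \<or> - w \<in> P \<longleftrightarrow> D w \<in> M \<or> - D w \<in> M"
  by (simp add: P_def blowup_uminus)

lemma walk_D_imp_walk:
  assumes "(D x, q) \<in> (moves M)\<^sup>*" "0 \<le> x"
  shows "\<exists>y. q = D y \<and> 0 \<le> y \<and> (x, y) \<in> (moves P)\<^sup>*"
  using assms(1)
proof (induction rule: rtrancl_induct)
  case (step q r)
  then obtain y where y: "q = D y" "0 \<le> y" "(x, y) \<in> (moves P)\<^sup>*" by blast
  have r: "0 \<le> r" "q - r \<in> M \<or> r - q \<in> M" using step.hyps(2) by (auto simp: moves_def)
  then have "q - r \<in> int_kernel A" using signed_M_kernel[of "q - r"] by simp
  then obtain w where w: "q - r = D w" by (auto simp: kernel)
  have req: "r = D (y - w)" using w y(1) by (simp add: blowup_diff algebra_simps)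
  have "0 \<le> y - w" using r(1) D_nonneg_iff[of "y - w"] by (simp add: req)
  moreover from this have "(y, y - w) \<in> moves P"
    using y(2) r(2) by (auto simp: moves_def P_def req y(1) blowup_diff blowup_uminus)
  ultimately show ?case using req rtrancl_into_rtrancl[OF y(3)] by blast
qed (use assms(2) in auto)

lemma walk_imp_walk_D:
  assumes "(x, y) \<in> (moves (P - {m, - m}))\<^sup>*"
  shows "(D x, D y) \<in> (moves (M - {D m, - D m}))\<^sup>*"
  using assms
proof (induction rule: rtrancl_induct)
  case (step y z)
  have eq: "D y - D z = D (y - z)" "D z - D y = D (z - y)" by (simp_all add: blowup_diff)
  have "(D y, D z) \<in> moves (M - {D m, - D m})"
    using step.hyps(2) unfolding moves_def
    by (auto simp: eq D_nonneg_iff P_def simp flip: blowup_uminus)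
  with step.IH show ?case by (rule rtrancl_into_rtrancl)
qed simp

sublocale minimal_markov_plane N P
proof
  show "\<forall>l. N $ l > 0" by (rule N_pos)
  show "P \<subseteq> plane N" using M_kernel by (auto simp: P_def simp flip: D_kernel_iff)
  show "(pos_part w, neg_part w) \<in> (moves P)\<^sup>*" if "w \<in> plane N" for w
  proof -
    have "(D (pos_part w), D (neg_part w)) \<in> (moves M)\<^sup>*"
      using M_connects[of "D w"] that by (simp add: pos_part_D neg_part_D)
    from walk_D_imp_walk[OF this] show ?thesis by auto
  qed
  show "(pos_part m, neg_part m) \<notin> (moves (P - {m, - m}))\<^sup>*" if "m \<in> P" for m
    using walk_imp_walk_D[of "pos_part m" "neg_part m" m] M_indispensable[of "D m"] that
    by (auto simp: P_def pos_part_D neg_part_D)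
qed

lemma coprime_entries_D_iff: "coprime_entries (D u) \<longleftrightarrow> coprime_entries u"
proof
  assume "coprime_entries (D u)"
  then show "coprime_entries u" unfolding coprime_entries_iff by simp
next
  assume u: "coprime_entries u"
  show "coprime_entries (D u)"
    unfolding coprime_entries_iff
  proof (intro allI impI)
    fix g assume g: "\<forall>j. g dvd D u $ j"
    have "g dvd u $ l" for l
    proof -
      have "g dvd Gcd ((*) (u $ l) ` \<gamma> ` {j. \<beta> j = l})"
        using g by (intro Gcd_greatest) (auto simp: mult.commute)
      then show ?thesis using \<gamma>_coprime[of l] by (simp add: Gcd_mult)
    qed
    then show "g dvd 1" using u unfolding coprime_entries_iff by blast
  qed
qed

text \<open>
  Blowing up preserves and reflects inclusions between supports, and also coprimality, because the
  entries of each encoding vector are coprime.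
\<close>

lemma circuit_D_iff:
  "circuit A (D u) \<longleftrightarrow> u \<in> plane N \<and> u \<noteq> 0 \<and> (\<exists>l. u $ l = 0) \<and> coprime_entries u"
proof -
  have supp: "vec_support (D w) = \<beta> -` vec_support w" for w
    by (auto simp: vec_support_def \<gamma>_nz)
  have surj: "surj \<beta>" using \<gamma>_pos unfolding surj_def by metis
  have "\<beta> -` S \<subseteq> \<beta> -` S' \<longleftrightarrow> S \<subseteq> S'" for S S'
    by (metis image_mono surj surj_image_vimage_eq vimage_mono)
  then have "vec_support (D w) \<subset> vec_support (D u) \<longleftrightarrow> vec_support w \<subset> vec_support u" for w
    unfolding supp less_le_not_le by blast
  then have "circuit A (D u) \<longleftrightarrow> u \<in> plane N \<and> u \<noteq> 0 \<and>
    (\<forall>w\<in>plane N. w \<noteq> 0 \<longrightarrow> \<not> vec_support w \<subset> vec_support u) \<and> coprime_entries u"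
    unfolding circuit_def kernel by (auto simp: coprime_entries_D_iff)
  then show ?thesis using support_minimal_iff_zero_coordinate[OF N_pos] by blast
qed


lemma unreduced_imp_two_edge_moves:
  assumes "u \<in> plane N" "u \<noteq> 0" "\<not> distance_reduces M (D u)"
  obtains i j k v v' where "two_edge_moves N P i j k v v'" "u $ k = 0"
proof -
  obtain i j k v v' where "\<omega> = UNIV" and ijk: "i \<noteq> j" "j \<noteq> k" "i \<noteq> k" "u $ k = 0"
    and P: "D v \<in> M \<or> - D v \<in> M" "D v' \<in> M \<or> - D v' \<in> M"
    and coords: "v $ i > 0" "v $ j = 0" "v $ k < 0" "v' $ i = 0" "v' $ j > 0" "v' $ k < 0"
    by (rule unreduced_edge[OF assms])
  have "two_edge_moves N P i j k v v'"
    by unfold_locales (use ijk P coords in \<open>simp_all add: P_signed_iff\<close>)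
  then show ?thesis using that ijk(4) by blast
qed

text \<open>
  Each circuit has a zero coordinate. If both vanished at the same coordinate, they would agree up to
  sign, being coprime multiples of the same generator.
\<close>

lemma two_circuits_imp_two_edge_moves:
  assumes M: "x \<in> M" "y \<in> M" and ne: "x \<noteq> y" "x \<noteq> - y" and circ: "circuit A x" "circuit A y"
  obtains i j k v v' where "two_edge_moves N P i j k v v'"
proof -
  have "x \<in> D ` plane N" "y \<in> D ` plane N" using M M_kernel by (auto simp flip: kernel)
  then obtain u w where uw: "x = D u" "y = D w" by blast
  have u: "u \<in> plane N" "u \<noteq> 0" "coprime_entries u" and w: "w \<in> plane N" "w \<noteq> 0" "coprime_entries w"
    using circ by (simp_all add: uw circuit_D_iff)
  obtain j i where uj: "u $ j = 0" and wi: "w $ i = 0"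
    using circ by (auto simp: uw circuit_D_iff)
  have "i \<noteq> j"
  proof
    assume "i = j"
    obtain a b :: 3 where "a \<noteq> b" "b \<noteq> i" "a \<noteq> i"
      using exhaust_3[of i] that[of 1 2] that[of 1 3] that[of 2 3] by auto
    then obtain c where "\<And>w. w \<in> plane N \<Longrightarrow> w $ i = 0 \<Longrightarrow> \<exists>t. w = t *s c"
      using edge_generator[OF N_pos, of a b i] by blast
    then obtain s t where st: "u = s *s c" "w = t *s c" using u w uj wi \<open>i = j\<close> by blast
    then have "s = 1 \<or> s = - 1" "t = 1 \<or> t = - 1" using u w coprime_scale_unit by blast+
    then have "u = w \<or> u = - w" by (auto simp: st vec_eq_iff)
    then show False using ne by (auto simp: uw blowup_uminus)
  qed
  moreover obtain k where "k \<noteq> i" "k \<noteq> j"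
  proof -
    have "card {i, j} \<noteq> CARD(3)" using \<open>i \<noteq> j\<close> by simp
    then have "{i, j} \<noteq> UNIV" by auto
    then show ?thesis using that by blast
  qed
  ultimately have ijk: "i \<noteq> j" "j \<noteq> k" "i \<noteq> k" by auto
  have nz: "u $ i \<noteq> 0" "w $ j \<noteq> 0"
    using plane_two_zeros[OF N_pos ijk u(1)] plane_two_zeros[OF N_pos ijk w(1)] u w uj wi by auto
  define v where "v = (if u $ i > 0 then u else - u)"
  define v' where "v' = (if w $ j > 0 then w else - w)"
  have "two_edge_moves N P i j k v v'"
  proof unfold_locales
    show "v \<in> P \<or> - v \<in> P" "v' \<in> P \<or> - v' \<in> P"
      using M by (auto simp: v_def v'_def P_def uw)
  qed (use ijk nz uj wi in \<open>auto simp: v_def v'_def\<close>)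
  then show ?thesis by (rule that)
qed

end

section \<open>The third circuit\<close>

lemma graver_basis_uminus: "- z \<in> graver_basis A \<Longrightarrow> z \<in> graver_basis A"
proof -
  assume z: "- z \<in> graver_basis A"
  have "z \<in> int_kernel A" using z int_kernel_uminus[of "- z" A] by (simp add: graver_basis_def)
  moreover have "\<not> (\<exists>u\<in>int_kernel A. \<exists>v\<in>int_kernel A. u \<noteq> 0 \<and> v \<noteq> 0 \<and> z = u + v \<and>
      pos_part z = pos_part u + pos_part v \<and> neg_part z = neg_part u + neg_part v)"
  proof clarify
    fix u v assume uv: "u \<in> int_kernel A" "v \<in> int_kernel A" "u \<noteq> 0" "v \<noteq> 0" "z = u + v"
      "pos_part (u + v) = pos_part u + pos_part v" "neg_part (u + v) = neg_part u + neg_part v"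
    have "- u \<in> int_kernel A" "- v \<in> int_kernel A" "- u \<noteq> 0" "- v \<noteq> 0" "- z = - u + - v"
      using uv by (simp_all add: int_kernel_uminus)
    moreover have "pos_part (- z) = pos_part (- u) + pos_part (- v)"
      "neg_part (- z) = neg_part (- u) + neg_part (- v)"
      unfolding pos_part_uminus neg_part_uminus using uv(5-7) by simp_all
    ultimately show False using z unfolding graver_basis_def by blast
  qed
  ultimately show ?thesis using z by (simp add: graver_basis_def)
qed

text \<open>
  Up to sign, \<open>M\<close> consists of \<open>D v\<close> and \<open>D v'\<close>. The only circuit missing from it is supported on the bouquets
  \<open>i\<close> and \<open>j\<close>.
\<close>

locale robust_two_edge_moves = nonmixed_robust_markov +
  fixes i j k :: 3 and v v' :: "int ^ 3"
  assumes two_edge: "two_edge_moves N P i j k v v'"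
begin

interpretation two_edge_moves N P i j k v v' by (rule two_edge)

lemma v_multiple: "w \<in> plane N \<Longrightarrow> w $ j = 0 \<Longrightarrow> \<exists>t. w = t *s v"
  and v'_multiple: "w \<in> plane N \<Longrightarrow> w $ i = 0 \<Longrightarrow> \<exists>t. w = t *s v'"
proof -
  assume w: "w \<in> plane N"
  obtain a b where ab: "w = a *s v + b *s v'" using plane_spanned[OF w] .
  show "\<exists>t. w = t *s v" if "w $ j = 0"
    using that v_coords v'_coords by (intro exI[of _ a]) (simp add: ab vec_eq_iff)
  show "\<exists>t. w = t *s v'" if "w $ i = 0"
    using that v_coords v'_coords by (intro exI[of _ b]) (simp add: ab vec_eq_iff)
qed

text \<open>
  Dividing \<open>x\<close> by a common factor gives another vector of the plane vanishing at \<open>p\<close>, which must again be a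
  multiple of \<open>x\<close>.
\<close>

lemma coprime_if_generates:
  assumes "x \<in> plane N" "x $ l \<noteq> 0" "x $ p = 0"
    and "\<And>w. w \<in> plane N \<Longrightarrow> w $ p = 0 \<Longrightarrow> \<exists>t. w = t *s x"
  shows "coprime_entries x"
  unfolding coprime_entries_iff
proof (intro allI impI)
  fix g assume g: "\<forall>l. g dvd x $ l"
  define y :: "int ^ 3" where "y = (\<chi> l. x $ l div g)"
  have xy: "x = g *s y" using g by (simp add: y_def vec_eq_iff)
  have g0: "g \<noteq> 0" using assms(2) by (auto simp: xy)
  have "g * weight N y = 0" using assms(1) by (simp add: xy plane_def weight_scale)
  then have "y \<in> plane N" using g0 by (simp add: plane_def)
  moreover have "y $ p = 0" using assms(3) g0 by (simp add: xy)
  ultimately obtain t where t: "y = t *s x" using assms(4) by blast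
  have "x $ l = g * (t * x $ l)" by (metis t vector_smult_component xy)
  then have "(g * t - 1) * x $ l = 0" by (simp add: algebra_simps)
  then have "1 = g * t" using assms(2) by simp
  then show "g dvd 1" by (metis dvd_triv_left)
qed

lemma circuit_v: "circuit A (D v)" and circuit_v': "circuit A (D v')"
  unfolding circuit_D_iff
  using v_plane v'_plane v_coords v'_coords coprime_if_generates[of v i j] v_multiple
    coprime_if_generates[of v' j i] v'_multiple by auto

lemma two_circuits_in_M:
  "\<exists>x\<in>M. \<exists>y\<in>M. x \<noteq> y \<and> x \<noteq> - y \<and> circuit A x \<and> circuit A y"
proof -
  have uminus: "circuit A (- D w)" if "circuit A (D w)" for w
  proof -
    have "circuit A (D (- w))" using that unfolding circuit_D_iff by (simp add: plane_uminus)
    then show ?thesis by (simp add: blowup_uminus)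
  qed
  obtain x where x: "x \<in> M" "x = D v \<or> x = - D v" using v_P P_signed_iff[of v] by auto
  obtain y where y: "y \<in> M" "y = D v' \<or> y = - D v'" using v'_P P_signed_iff[of v'] by auto
  have "v \<noteq> v'" "v \<noteq> - v'" using v_coords v'_coords by auto
  then have "D v \<noteq> D v'" "D v \<noteq> D (- v')" by simp_all
  then have "D v \<noteq> D v'" "D v \<noteq> - D v'" "- D v \<noteq> D v'"
    by (auto simp: blowup_uminus) (metis minus_minus)
  then have "x \<noteq> y" "x \<noteq> - y" using x(2) y(2) by auto
  moreover have "circuit A x" "circuit A y"
    using x(2) y(2) uminus circuit_v circuit_v' by auto
  ultimately show ?thesis using x(1) y(1) by blast
qed

lemma signed_M_D: "D w \<in> M \<or> - D w \<in> M \<Longrightarrow> w \<in> {v, - v, v', - v'}"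
  using P_subset P_signed_iff[of w] by auto

text \<open>
  A move that fits below \<open>c\<close> or \<open>- c\<close> cannot be positive at \<open>k\<close>. This leaves \<open>v\<close> and \<open>v'\<close>,
  whose only negative coordinate is \<open>k\<close>, where \<open>c\<close> vanishes.
\<close>

lemma edge_unreduced:
  assumes "c $ k = 0" "c $ i > 0" "c $ j < 0"
  shows "\<not> distance_reduces M (D c)"
proof
  assume "distance_reduces M (D c)"
  then obtain m b l where m: "m \<in> M \<or> - m \<in> M" and b: "b \<in> {D c, - D c}"
    and le: "pos_part m \<le> pos_part b" and neg: "m $ l < 0" "b $ l < 0"
    unfolding M_reduces_iff by blast
  obtain w where w: "m = D w" using signed_M_kernel[OF m] by (auto simp: kernel)
  have w_cases: "w \<in> {v, - v, v', - v'}" using signed_M_D m w by blast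
  obtain d where d: "d \<in> {c, - c}" "b = D d" using b by (auto simp flip: blowup_uminus)
  have "pos_part w \<le> pos_part d" using le by (simp add: w d pos_part_D D_le_iff)
  then have "pos_part w $ p \<le> pos_part d $ p" for p by (simp add: less_eq_vec_def)
  from this[of i] this[of j] this[of k]
  have "w $ i \<le> max (d $ i) 0" "w $ j \<le> max (d $ j) 0" "w $ k \<le> max (d $ k) 0" by simp_all
  moreover have "w $ \<beta> l < 0" "d $ \<beta> l < 0"
    using neg by (simp_all add: w d mult_less_0_iff)
  moreover have "\<beta> l = i \<or> \<beta> l = j \<or> \<beta> l = k" using three_indices[OF ijk] by blast
  ultimately show False
    using w_cases d(1) assms v_coords v'_coords v_k v'_k by (auto simp: max_def split: if_splits)
qed

text \<open>
  A multiple \<open>t c\<close> with \<open>\<bar>t\<bar> \<ge> 2\<close> splits off one copy of \<open>\<plusminus>c\<close> without cancellation.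
\<close>

lemma graver_edge_multiple:
  assumes "D (t *s c) \<in> graver_basis A" "c \<in> plane N"
  shows "t = 1 \<or> t = - 1"
proof (rule ccontr)
  assume t: "\<not> (t = 1 \<or> t = - 1)"
  have t0: "t \<noteq> 0" and c0: "c \<noteq> 0" using assms(1)
    by (auto simp: graver_basis_def)
  define s where "s = sgn t"
  have s: "s = 1 \<and> t - s > 0 \<or> s = - 1 \<and> t - s < 0" using t t0 by (auto simp: s_def sgn_if)
  let ?x = "s *s c" and ?y = "(t - s) *s c"
  have "D (t *s c) = D ?x + D ?y" by (simp add: vec_eq_iff algebra_simps)
  moreover have "pos_part (D (t *s c)) = pos_part (D ?x) + pos_part (D ?y)"
    "neg_part (D (t *s c)) = neg_part (D ?x) + neg_part (D ?y)"
  proof -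
    have "max (t * a) 0 = max (s * a) 0 + max ((t - s) * a) 0"
      "max (- (t * a)) 0 = max (- (s * a)) 0 + max (- ((t - s) * a)) 0" for a :: int
    proof -
      have "(s * a \<ge> 0 \<and> (t - s) * a \<ge> 0) \<or> (s * a \<le> 0 \<and> (t - s) * a \<le> 0)"
        using s by (auto simp: zero_le_mult_iff mult_le_0_iff)
      moreover have "t * a = s * a + (t - s) * a" by (simp add: algebra_simps)
      ultimately show "max (t * a) 0 = max (s * a) 0 + max ((t - s) * a) 0"
        "max (- (t * a)) 0 = max (- (s * a)) 0 + max (- ((t - s) * a)) 0" by linarith+
    qed
    then have "pos_part (t *s c) = pos_part ?x + pos_part ?y"
      "neg_part (t *s c) = neg_part ?x + neg_part ?y"
      unfolding vec_eq_iff pos_part_nth neg_part_nth vector_add_component vector_smult_component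
      by blast+
    then show "pos_part (D (t *s c)) = pos_part (D ?x) + pos_part (D ?y)"
      "neg_part (D (t *s c)) = neg_part (D ?x) + neg_part (D ?y)"
      by (simp_all add: pos_part_D neg_part_D blowup_add)
  qed
  moreover have "?x \<noteq> 0" "?y \<noteq> 0" using s c0 by (auto simp: vec_eq_iff)
  then have "D ?x \<noteq> 0" "D ?y \<noteq> 0" by simp_all
  moreover have "D ?x \<in> int_kernel A" "D ?y \<in> int_kernel A"
    unfolding D_kernel_iff by (intro plane_scale assms(2))+
  ultimately show False using assms(1) unfolding graver_basis_def by blast
qed

text \<open>
  In a decomposition without cancellation both summands vanish at \<open>k\<close>, so they are positive multiples of
  \<open>c\<close> that add up to \<open>c\<close>.
\<close>

lemma edge_in_graver:
  assumes c: "c \<in> plane N" "c $ k = 0" "c $ i > 0"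
    and gen: "\<And>w. w \<in> plane N \<Longrightarrow> w $ k = 0 \<Longrightarrow> \<exists>t. w = t *s c"
  shows "D c \<in> graver_basis A"
  unfolding graver_basis_def
proof (intro CollectI conjI notI)
  show "D c \<in> int_kernel A" using c by simp
  show "D c = 0 \<Longrightarrow> False" using c(3) by auto
  assume "\<exists>x\<in>int_kernel A. \<exists>y\<in>int_kernel A. x \<noteq> 0 \<and> y \<noteq> 0 \<and> D c = x + y \<and>
      pos_part (D c) = pos_part x + pos_part y \<and> neg_part (D c) = neg_part x + neg_part y"
  then obtain x y where xy: "x \<in> plane N" "y \<in> plane N" "x \<noteq> 0" "y \<noteq> 0" "D c = D x + D y"
    "pos_part (D c) = pos_part (D x) + pos_part (D y)"
    "neg_part (D c) = neg_part (D x) + neg_part (D y)"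
    unfolding kernel by auto
  have sum: "c = x + y" "pos_part c = pos_part x + pos_part y" "neg_part c = neg_part x + neg_part y"
    using xy(5-7) by (simp_all add: pos_part_D neg_part_D flip: blowup_add)
  have coord: "max (c $ l) 0 = max (x $ l) 0 + max (y $ l) 0"
    "max (- c $ l) 0 = max (- x $ l) 0 + max (- y $ l) 0" for l
    using arg_cong[OF sum(2), of "\<lambda>z. z $ l"] arg_cong[OF sum(3), of "\<lambda>z. z $ l"] by simp_all
  have "x $ k = 0" "y $ k = 0" using coord[of k] c(2) by linarith+
  then obtain s t where st: "x = s *s c" "y = t *s c" using gen xy(1,2) by blast
  have nz: "s \<noteq> 0" "t \<noteq> 0" using xy(3,4) by (auto simp: st vec_eq_iff)
  have "x $ i \<ge> 0" "y $ i \<ge> 0" using coord(2)[of i] c(3) by linarith+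
  then have "s > 0" "t > 0" using nz c(3) by (simp_all add: st zero_le_mult_iff)
  moreover have "(s + t - 1) * c $ i = 0"
    using arg_cong[OF sum(1), of "\<lambda>z. z $ i"] by (simp add: st algebra_simps)
  ultimately show False using c(3) by simp
qed

text \<open>
  In the plane, every element that is not reduced vanishes at a coordinate where two vectors of \<open>\<plusminus>P\<close>
  with different zero coordinates are both nonzero. As \<open>\<plusminus>P\<close> contains only \<open>\<plusminus>v\<close> and \<open>\<plusminus>v'\<close>, this is
  coordinate \<open>k\<close>, so the element is a multiple of the third circuit.
\<close>

lemma unreduced_graver_is_third_circuit:
  "\<exists>c. {c'. circuit A c' \<and> c' \<notin> M \<and> - c' \<notin> M} = {c, - c} \<and>
       {z \<in> graver_basis A. \<not> distance_reduces M z} = {c, - c}"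
proof -
  obtain c where c: "c \<in> plane N" "c $ i > 0" "c $ k = 0" "coprime_entries c"
    and gen: "\<And>w. w \<in> plane N \<Longrightarrow> w $ k = 0 \<Longrightarrow> \<exists>t. w = t *s c"
    using edge_generator[OF N_pos ijk] by blast
  have c0: "c \<noteq> 0" using c(2) by auto
  have "c $ j < 0" using third_coord_neg[of N i k j c] N_pos ijk c by auto
  then have unred: "\<not> distance_reduces M (D c)" using edge_unreduced c by blast
  have unit: "D (t *s c) \<in> {D c, - D c}" if "t = 1 \<or> t = - 1" for t
    using that by (auto simp: vec_eq_iff)
  have not_P: "c \<notin> {v, - v, v', - v'}" "- c \<notin> {v, - v, v', - v'}"
    using c(3) v_k v'_k by auto
  have "{c'. circuit A c' \<and> c' \<notin> M \<and> - c' \<notin> M} = {D c, - D c}"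
  proof (intro equalityI subsetI)
    fix z assume "z \<in> {c'. circuit A c' \<and> c' \<notin> M \<and> - c' \<notin> M}"
    then have z: "circuit A z" "z \<notin> M" "- z \<notin> M" by auto
    then obtain w where w: "z = D w" "w \<in> plane N" by (auto simp: circuit_def kernel)
    obtain l where l: "w $ l = 0" and cop: "coprime_entries w"
      using z(1) by (auto simp: w circuit_D_iff)
    have unsigned: "t = 1 \<or> t = - 1" if "w = t *s x" for t x
      using cop coprime_scale_unit that by blast
    have "D v \<in> M \<or> - D v \<in> M" "D v' \<in> M \<or> - D v' \<in> M"
      using v_P v'_P P_signed_iff by blast+
    then have ne: "w \<noteq> v" "w \<noteq> - v" "w \<noteq> v'" "w \<noteq> - v'"
      using z(2,3) by (auto simp: w blowup_uminus)
    have smult: "1 *s x = x" "(- 1) *s x = - x" for x :: "int ^ 3" by (simp_all add: vec_eq_iff)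
    have "w $ j \<noteq> 0" using v_multiple[OF w(2)] unsigned ne smult by metis
    moreover have "w $ i \<noteq> 0" using v'_multiple[OF w(2)] unsigned ne smult by metis
    ultimately have "w $ k = 0" using l three_indices[OF ijk] by (metis UNIV_I empty_iff insert_iff)
    then obtain t where "w = t *s c" using gen w(2) by blast
    then show "z \<in> {D c, - D c}" using unit unsigned w(1) by blast
  next
    fix z assume "z \<in> {D c, - D c}"
    then obtain d where d: "z = D d" "d \<in> {c, - c}" by (auto simp flip: blowup_uminus)
    have "circuit A z"
      unfolding d(1) circuit_D_iff using d(2) c c0 plane_uminus[OF c(1)] by auto
    moreover have "z \<notin> M" "- z \<notin> M" using signed_M_D[of d] d not_P by auto
    ultimately show "z \<in> {c'. circuit A c' \<and> c' \<notin> M \<and> - c' \<notin> M}" by simp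
  qed
  moreover have "{z \<in> graver_basis A. \<not> distance_reduces M z} = {D c, - D c}"
  proof (intro equalityI subsetI)
    fix z assume "z \<in> {z \<in> graver_basis A. \<not> distance_reduces M z}"
    then have z: "z \<in> graver_basis A" "\<not> distance_reduces M z" by auto
    then obtain w where w: "z = D w" "w \<in> plane N" "w \<noteq> 0"
      by (auto simp: graver_basis_def kernel)
    have "\<not> distance_reduces M (D w)" using z(2) w(1) by simp
    then obtain i' j' k' x x' where e: "two_edge_moves N P i' j' k' x x'" and wk': "w $ k' = 0"
      by (rule unreduced_imp_two_edge_moves[OF w(2,3)])
    have x: "x \<in> {v, - v, v', - v'}" "x' \<in> {v, - v, v', - v'}"
      using signed_M_D two_edge_moves.v_P[OF e] two_edge_moves.v'_P[OF e] P_signed_iff by blast+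
    have "k' = k"
    proof (rule ccontr)
      assume "k' \<noteq> k"
      then have "k' = i \<or> k' = j" using three_indices[OF ijk] by blast
      moreover have "x $ k' \<noteq> 0" "x' $ k' \<noteq> 0"
        using two_edge_moves.v_k[OF e] two_edge_moves.v'_k[OF e] by auto
      ultimately have "x' = x \<or> x' = - x" using x v_coords v'_coords by auto
      then show False
        using two_edge_moves.v_coords[OF e] two_edge_moves.v'_coords[OF e] by auto
    qed
    then obtain t where t: "w = t *s c" using gen w(2) wk' by blast
    then show "z \<in> {D c, - D c}"
      using unit graver_edge_multiple[of t c] z(1) c(1) w(1) by blast
  next
    fix z assume z: "z \<in> {D c, - D c}"
    have "D c \<in> graver_basis A" using edge_in_graver c gen by blast
    then have "z \<in> graver_basis A" using z graver_basis_uminus[of "- D c" A] by auto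
    moreover have "\<not> distance_reduces M z" using z unred by auto
    ultimately show "z \<in> {z \<in> graver_basis A. \<not> distance_reduces M z}" by simp
  qed
  ultimately show ?thesis by blast
qed

lemma not_distance_reducing: "\<not> distance_reducing A M"
proof -
  obtain c where "{z \<in> graver_basis A. \<not> distance_reduces M z} = {c, - c}"
    using unreduced_graver_is_third_circuit by blast
  then have "c \<in> graver_basis A" "\<not> distance_reduces M c" by blast+
  then show ?thesis by (auto simp: distance_reducing_def graver_basis_def)
qed

end

theorem theorem4p18:
  fixes n1 n2 n3 :: int
    and T :: "int ^ 3 ^ 1"
    and \<omega> :: "3 set"
    and A :: "int ^ 'n::{finite,linorder} ^ 'd::finite"
    and M :: "(int ^ 'n::{finite,linorder}) set"
  assumes "n1 > 0" and "n2 > 0" and "n3 > 0"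
    and "T = row_matrix3 n1 n2 n3"
    and "pointed A"
    and "homogeneous_matrix A"
    and "robust TYPE('k::field) T \<omega> A"
    and "minimal_markov_basis TYPE('k) A M"
  shows "(\<not> distance_reducing A M \<longleftrightarrow>
            \<omega> = UNIV \<and>
            complete_intersection TYPE('k) T \<and>
            (\<exists>u\<in>M. \<exists>v\<in>M. u \<noteq> v \<and> u \<noteq> - v \<and> circuit A u \<and> circuit A v))
         \<and> (\<not> distance_reducing A M \<longrightarrow>
            (\<exists>c. {c'. circuit A c' \<and> c' \<notin> M \<and> - c' \<notin> M} = {c, - c} \<and>
                 {z \<in> graver_basis A. \<not> distance_reduces M z} = {c, - c}))"
proof -
  define N :: "int ^ 3" where "N = vector [n1, n2, n3]"
  have T: "int_kernel T = plane N" by (simp add: assms(4) N_def int_kernel_row_matrix3)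
  obtain \<beta> \<gamma> where bouquets: "int_kernel A = blowup \<beta> \<gamma> ` int_kernel T"
    "\<And>j. \<gamma> j \<noteq> 0" "\<And>l. \<exists>j. \<beta> j = l \<and> \<gamma> j > 0" "\<And>l. Gcd (\<gamma> ` {j. \<beta> j = l}) = 1"
    "\<And>l. l \<in> \<omega> \<longleftrightarrow> (\<forall>j. \<beta> j = l \<longrightarrow> \<gamma> j > 0)"
    using robust_blowup[OF assms(7)] by blast
  have markov: "markov_basis TYPE('k) A M"
    using assms(8) by (simp add: minimal_markov_basis_def)
  interpret robust_markov A N \<beta> \<gamma> \<omega> M
  proof
    show "\<forall>l. N $ l > 0" unfolding N_def using assms(1-3) by (simp add: forall_3)
    show "(\<Sum>j\<in>UNIV. u $ j) = 0" if "u \<in> int_kernel A" for u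
      by (rule homogeneous_kernel_sum_zero[OF assms(6) that])
    show "(pos_part m, neg_part m) \<notin> (moves (M - {m, - m}))\<^sup>*" if "m \<in> M" for m
      by (rule minimal_markov_basis_indispensable[OF assms(8) that])
  qed (use bouquets T markov in \<open>auto simp: markov_basis_iff_walks\<close>)
  let ?circuits = "\<exists>u\<in>M. \<exists>v\<in>M. u \<noteq> v \<and> u \<noteq> - v \<and> circuit A u \<and> circuit A v"
  let ?third = "\<exists>c. {c'. circuit A c' \<and> c' \<notin> M \<and> - c' \<notin> M} = {c, - c} \<and>
      {z \<in> graver_basis A. \<not> distance_reduces M z} = {c, - c}"
  have config: "complete_intersection TYPE('k) T \<and> ?circuits \<and> ?third \<and> \<not> distance_reducing A M"
    if "\<omega> = UNIV" and e: "two_edge_moves N {w. D w \<in> M} i j k v v'" for i j k v v'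
  proof -
    interpret nonmixed_robust_markov A N \<beta> \<gamma> \<omega> M by unfold_locales (rule that(1))
    interpret robust_two_edge_moves A N \<beta> \<gamma> \<omega> M i j k v v'
      by (intro robust_two_edge_moves.intro robust_two_edge_moves_axioms.intro
          nonmixed_robust_markov_axioms) (use e in \<open>simp add: P_def\<close>)
    show ?thesis
      using two_edge_moves.complete_intersection[OF e N_def] two_circuits_in_M
        unreduced_graver_is_third_circuit not_distance_reducing
      by (simp add: assms(4))
  qed
  have forward: "\<omega> = UNIV \<and> complete_intersection TYPE('k) T \<and> ?circuits \<and> ?third"
    if unreducing: "\<not> distance_reducing A M"
  proof -
    obtain u where u: "u \<in> plane N" "u \<noteq> 0" "\<not> distance_reduces M (D u)"
    proof -
      obtain z where z: "z \<in> int_kernel A" "z \<noteq> 0" "\<not> distance_reduces M z"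
        using unreducing by (auto simp: distance_reducing_def)
      then obtain u where "u \<in> plane N" "z = D u" by (auto simp: kernel)
      with z show ?thesis by (intro that) auto
    qed
    have \<omega>: "\<omega> = UNIV" using unreduced_edge[OF u] by blast
    interpret nonmixed_robust_markov A N \<beta> \<gamma> \<omega> M by unfold_locales (rule \<omega>)
    obtain i j k v v' where "two_edge_moves N P i j k v v'"
      by (rule unreduced_imp_two_edge_moves[OF u])
    from config[OF \<omega> this[unfolded P_def]] \<omega> show ?thesis by (elim conjE) (intro conjI)
  qed
  have backward: "\<not> distance_reducing A M" if full: "\<omega> = UNIV" and two: ?circuits
  proof -
    interpret nonmixed_robust_markov A N \<beta> \<gamma> \<omega> M by unfold_locales (rule full)
    obtain x y where xy: "x \<in> M" "y \<in> M" "x \<noteq> y" "x \<noteq> - y" "circuit A x" "circuit A y"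
      using two by blast
    obtain i j k v v' where "two_edge_moves N P i j k v v'"
      by (rule two_circuits_imp_two_edge_moves[OF xy])
    from config[OF full this[unfolded P_def]] show ?thesis by (elim conjE)
  qed
  show ?thesis
  proof (intro conjI iffI impI)
    assume "\<not> distance_reducing A M"
    note f = forward[OF this]
    show "\<omega> = UNIV" by (rule f[THEN conjunct1])
    show "complete_intersection TYPE('k) T" by (rule f[THEN conjunct2, THEN conjunct1])
    show ?circuits by (rule f[THEN conjunct2, THEN conjunct2, THEN conjunct1])
    show ?third by (rule f[THEN conjunct2, THEN conjunct2, THEN conjunct2])
  next
    assume "\<omega> = UNIV \<and> complete_intersection TYPE('k) T \<and> ?circuits"
    then show "\<not> distance_reducing A M" by (elim conjE) (rule backward)
  qed
qed

end
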